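(* There is a universal constant $C>0$ such that the following holds. Let $Y$ be a (real) Banach space whose norm belongs to $C^1(Y\setminus\{0\})$ and let $X\subset Y$ be a nonempty closed subset with finite doubling constant $\lambda$. Then there exists a regular random projection $\mu:Y\to\mathcal P(X)$, $y\mapsto\mu_y$, whose associated family of vector measures $\nu_y$ satisfies \[ \|\nu_y\|_{TV}\le C\,\frac{\lambda^4\log\lambda}{\mathrm{dist}(y,X)}\qquad\text{for all } y\in Y\setminus X . \]
   Context: $\mathcal P(X)$ is the set of Borel probability measures on $X$; $\mathcal M(X;Y^* )$ is the set of $Y^*$-valued Borel measures on $X$ with finite total variation, and $\|\cdot\|_{TV}$ is the total variation. $\mathrm{dist}(y,X)=\inf_{x\in X}|y-x|$. A map $\mu:Y\to\mathcal P(X)$ is a regular random projection if there is $\eta>0$ such that: (i) for every $y\in Y$ the measure $\mu_y$ is concentrated on the closed ball of center $y$ and radius $\eta\,\mathrm{dist}(y,X)$ (in particular $\mu_x=\delta_x$ for $x\in X$); (ii) for all $f\in C(X)$ the map $F(y)=\int_X f(x)\,d\mu_y(x)$ is well defined and belongs to $C(Y)\cap C^1(Y\setminus X)$, and there exists $\nu:Y\setminus X\to\mathcal M(X;Y^* )$ (not depending on $f$; this is the family associated with $\mu$) such that $dF_y=\int_X f(x)\,d\nu_y(x)$ for all $y\in Y\setminus X$; (iii) for all $y\in Y\setminus X$ the measure $\nu_y$ is concentrated on the closed ball of center $y$ and radius $\eta\,\mathrm{dist}(y,X)$, and $\|\nu_y\|_{TV}\le \dfrac{C_X}{\mathrm{dist}(y,X)}$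 for some constant $C_X$ independent of $y$. A metric space $X$ is doubling if there is $\lambda\in\mathbb N$ such that for every $r>0$ every (open) ball of radius $2r$ in $X$ can be covered by at most $\lambda$ balls of radius $r$ in $X$; the least such $\lambda$ is the doubling constant of $X$. "Universal" means that $C$ does not depend on $X,Y,\lambda$. *)

theory Defs
  imports "HOL-Probability.Probability"
begin

definition C1_on :: "('a::real_normed_vector \<Rightarrow> real) \<Rightarrow> 'a set \<Rightarrow> bool" where
  "C1_on f U \<longleftrightarrow> (\<exists>D :: 'a \<Rightarrow> ('a \<Rightarrow>\<^sub>L real).
     continuous_on U D \<and> (\<forall>y\<in>U. (f has_derivative blinfun_apply (D y)) (at y)))"

text \<open>Balls of the metric space X are the traces on X of ambient balls centred at points of X.\<close>

definition doubling_with :: "'a::metric_space set \<Rightarrow> nat \<Rightarrow> bool" where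
  "doubling_with X l \<longleftrightarrow> (\<forall>r>0. \<forall>x\<in>X. \<exists>S. S \<subseteq> X \<and> finite S \<and> card S \<le> l \<and>
     ball x (2 * r) \<inter> X \<subseteq> (\<Union>s\<in>S. ball s r))"

definition doubling_space :: "'a::metric_space set \<Rightarrow> bool" where
  "doubling_space X \<longleftrightarrow> (\<exists>l. doubling_with X l)"

definition doubling_constant :: "'a::metric_space set \<Rightarrow> nat" where
  "doubling_constant X = (LEAST l. doubling_with X l)"

abbreviation borel_on :: "'a::topological_space set \<Rightarrow> 'a measure" where
  "borel_on X \<equiv> restrict_space borel X"

definition borel_prob_measures :: "'a::topological_space set \<Rightarrow> 'a measure set" where
  "borel_prob_measures X = {M. prob_space M \<and> sets M = sets (borel_on X)}"

text \<open>A vector measure on X is a set function; its values outside the Borel sets of X are irrelevant.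
  Countable additivity forces the value 0 on the empty set.\<close>

definition vmeasure_variation ::
    "'a::topological_space set \<Rightarrow> ('a set \<Rightarrow> 'b::real_normed_vector) \<Rightarrow> 'a set \<Rightarrow> ennreal" where
  "vmeasure_variation X \<nu> A =
     (SUP P \<in> {P. finite P \<and> P \<subseteq> sets (borel_on X) \<and> disjoint P \<and> \<Union>P = A}.
        (\<Sum>E\<in>P. ennreal (norm (\<nu> E))))"

abbreviation TV_norm ::
    "'a::topological_space set \<Rightarrow> ('a set \<Rightarrow> 'b::real_normed_vector) \<Rightarrow> ennreal" where
  "TV_norm X \<nu> \<equiv> vmeasure_variation X \<nu> X"

definition finite_vmeasures ::
    "'a::topological_space set \<Rightarrow> ('a set \<Rightarrow> 'b::real_normed_vector) set" where
  "finite_vmeasures X = {\<nu>.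
     (\<forall>A :: nat \<Rightarrow> 'a set. range A \<subseteq> sets (borel_on X) \<longrightarrow> disjoint_family A \<longrightarrow>
        (\<lambda>i. \<nu> (A i)) sums \<nu> (\<Union>i. A i)) \<and>
     TV_norm X \<nu> < \<infinity>}"

text \<open>For countably additive \<open>\<nu>\<close> the variation is a genuine measure, so that \<open>measure_of\<close> does not
  fall back to the zero measure.\<close>

definition variation_measure ::
    "'a::topological_space set \<Rightarrow> ('a set \<Rightarrow> 'b::real_normed_vector) \<Rightarrow> 'a measure" where
  "variation_measure X \<nu> = measure_of X (sets (borel_on X)) (vmeasure_variation X \<nu>)"

text \<open>The integral of a scalar function against a vector measure: the limit of the integrals of simple
  functions that converge to \<open>f\<close> in the \<open>L\<^sup>1\<close> sense of the variation measure.\<close>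

definition has_vmeasure_integral ::
    "'a::topological_space set \<Rightarrow> ('a set \<Rightarrow> 'b::real_normed_vector) \<Rightarrow> ('a \<Rightarrow> real) \<Rightarrow> 'b \<Rightarrow> bool" where
  "has_vmeasure_integral X \<nu> f I \<longleftrightarrow>
     f \<in> borel_measurable (borel_on X) \<and>
     (\<exists>s :: nat \<Rightarrow> 'a \<Rightarrow> real.
        (\<forall>n. simple_function (borel_on X) (s n)) \<and>
        (\<lambda>n. \<integral>\<^sup>+x. ennreal \<bar>f x - s n x\<bar> \<partial>variation_measure X \<nu>) \<longlonglongrightarrow> 0 \<and>
        (\<lambda>n. \<Sum>c\<in>s n ` X. c *\<^sub>R \<nu> (s n -` {c} \<inter> X)) \<longlonglongrightarrow> I)"

text \<open>\<open>\<nu>\<close> is the associated family of \<open>\<mu>\<close>. The dual of the ambient space is \<open>'a \<Rightarrow>\<^sub>L real\<close> with the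
  operator norm. The functions in C(X) are continuous but not required to be bounded.\<close>

definition regular_random_projection_with ::
    "'a::real_normed_vector set \<Rightarrow> ('a \<Rightarrow> 'a measure) \<Rightarrow> ('a \<Rightarrow> 'a set \<Rightarrow> ('a \<Rightarrow>\<^sub>L real)) \<Rightarrow> bool" where
  "regular_random_projection_with X \<mu> \<nu> \<longleftrightarrow>
     (\<forall>y. \<mu> y \<in> borel_prob_measures X) \<and>
     (\<forall>y\<in>-X. \<nu> y \<in> finite_vmeasures X) \<and>
     (\<exists>\<eta>>0.
        (\<forall>y. AE x in \<mu> y. x \<in> cball y (\<eta> * infdist y X)) \<and>
        (\<forall>f. continuous_on X f \<longrightarrow>
           (\<forall>y. integrable (\<mu> y) f) \<and>
           continuous_on UNIV (\<lambda>y. \<integral>x. f x \<partial>\<mu> y) \<and>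
           C1_on (\<lambda>y. \<integral>x. f x \<partial>\<mu> y) (-X) \<and>
           (\<forall>y\<in>-X. \<exists>L. ((\<lambda>z. \<integral>x. f x \<partial>\<mu> z) has_derivative blinfun_apply L) (at y) \<and>
              has_vmeasure_integral X (\<nu> y) f L)) \<and>
        (\<forall>y\<in>-X. vmeasure_variation X (\<nu> y) (X - cball y (\<eta> * infdist y X)) = 0) \<and>
        (\<exists>C. \<forall>y\<in>-X. TV_norm X (\<nu> y) \<le> ennreal (C / infdist y X)))"

definition regular_random_projection ::
    "'a::real_normed_vector set \<Rightarrow> ('a \<Rightarrow> 'a measure) \<Rightarrow> bool" where
  "regular_random_projection X \<mu> \<longleftrightarrow> (\<exists>\<nu>. regular_random_projection_with X \<mu> \<nu>)"

text \<open>The universal constant. HOL cannot place an existential quantifier over a real number outside the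
  quantification over Banach spaces when these are types: an existentially bound constant inside the
  theorem could depend on the type \<open>'a\<close>. A closed term of type \<open>real\<close> cannot. The numerical value is
  not sharp and has no significance beyond being admissible.\<close>

definition universal_const :: real where
  "universal_const = 10 ^ 6"

end

theory Submission
  imports Defs
begin

text \<open>
  The measure \<open>\<mu> y\<close> is a weighted average of Dirac measures at finitely many points of \<open>X\<close> whose distance
  from \<open>y\<close> is comparable to \<open>d = infdist y X\<close>. Once the weights form a locally finite, continuously
  differentiable partition of unity on the complement of \<open>X\<close>, all the properties of a regular random
  projection are formal: \<open>\<nu> y\<close> is the combination of the same Dirac measures with the derivatives of the
  weights as coefficients, and its total variation is at most the sum of the norms of these derivatives
  (locale \<open>projection_partition\<close>).

  A Whitney covering of the complement of \<open>X\<close> cannot supply the weights, since it need not be locally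
  finite in an infinite-dimensional \<open>Y\<close>. The weights are indexed by points of \<open>X\<close> instead. For each integer \<open>k\<close> let \<open>N k\<close> be a
  maximal \<open>2 powi k\<close>-separated subset of \<open>X\<close>; by the doubling property at most \<open>l ^ 4\<close> of its points are
  within \<open>4 * 2 powi k\<close> of \<open>y\<close> (\<open>card_near_le\<close>). Each of them gets a bump that depends on its distance
  from \<open>y\<close> only; the bump is differentiable because the norm is differentiable away from \<open>0\<close>. The
  function \<open>infdist y X\<close> is in general not differentiable and cannot be used to select the right scale.
  The sum \<open>cov k y\<close> of the bumps takes over this task: it is \<open>0\<close> if \<open>d \<ge> 4 * 2 powi k\<close> and at
  least \<open>1\<close> if \<open>d < 2 * 2 powi k\<close>. The net \<open>N k\<close> distributes the mass \<open>1 - gap (cov k y)\<close> among its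
  points in proportion to their bumps, but only that part of the mass which \<open>N (k - 1)\<close> has left over:
  the weight of \<open>x\<close> at scale \<open>k\<close> contains the factor \<open>gap (cov (k - 1) y)\<close>. If
  \<open>2 * 2 powi k \<le> d < 4 * 2 powi k\<close>, then the gap is \<open>1\<close> at all scales below \<open>k\<close> and \<open>0\<close> at all scales
  above \<open>k\<close>. Hence only the scales \<open>k\<close> and \<open>k + 1\<close> are active and the weights add up to \<open>1\<close>
  (\<open>weight_total\<close>).

  The derivative of a bump at scale \<open>k\<close> has norm at most \<open>8 / 2 powi k\<close>, at most \<open>l ^ 4\<close> bumps matter
  at each of the two active scales, and rescaling costs only a numerical factor. This gives the bound
  \<open>768 * l ^ 4 / d\<close> for the total variation (\<open>sum_norm_weight'_act_le\<close>). If \<open>l \<ge> 2\<close>, then \<open>ln l\<close> is at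
  least \<open>1 / 2\<close>, so this is better than what is claimed; if \<open>l = 1\<close>, then \<open>X\<close> is a single point and the
  constant projection has \<open>\<nu> = 0\<close>.
\<close>

section \<open>Calculus of continuously differentiable functions with a named derivative\<close>

text \<open>Naming the derivative makes it possible to estimate the derivatives of the weights one by one.\<close>

definition C1_deriv ::
    "'a::real_normed_vector set \<Rightarrow> ('a \<Rightarrow> real) \<Rightarrow> ('a \<Rightarrow> 'a \<Rightarrow>\<^sub>L real) \<Rightarrow> bool" where
  "C1_deriv U f D \<longleftrightarrow>
     continuous_on U D \<and> (\<forall>y\<in>U. (f has_derivative blinfun_apply (D y)) (at y))"

lemma C1_deriv_imp_C1_on: "C1_deriv U f D \<Longrightarrow> C1_on f U"
  by (auto simp: C1_deriv_def C1_on_def)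

lemma C1_deriv_imp_continuous_on: "C1_deriv U f D \<Longrightarrow> continuous_on U f"
  unfolding C1_deriv_def continuous_on_eq_continuous_within
  by (auto intro: has_derivative_continuous has_derivative_at_withinI)

lemma C1_deriv_sum:
  assumes "\<And>i. i \<in> T \<Longrightarrow> C1_deriv U (w i) (D i)"
  shows "C1_deriv U (\<lambda>y. \<Sum>i\<in>T. w i y) (\<lambda>y. \<Sum>i\<in>T. D i y)"
  unfolding C1_deriv_def
proof (intro conjI ballI)
  show "continuous_on U (\<lambda>y. \<Sum>i\<in>T. D i y)"
    using assms by (intro continuous_on_sum) (auto simp: C1_deriv_def)
  fix y assume "y \<in> U"
  have "((\<lambda>y. \<Sum>i\<in>T. w i y) has_derivative (\<lambda>v. \<Sum>i\<in>T. blinfun_apply (D i y) v)) (at y)"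
    using assms \<open>y \<in> U\<close> by (intro has_derivative_sum) (auto simp: C1_deriv_def)
  then show "((\<lambda>y. \<Sum>i\<in>T. w i y) has_derivative blinfun_apply (\<Sum>i\<in>T. D i y)) (at y)"
    by (simp add: blinfun.sum_left[abs_def] cong: if_cong)
qed

lemma C1_deriv_mult:
  assumes "C1_deriv U f D" "C1_deriv U g E"
  shows "C1_deriv U (\<lambda>y. f y * g y) (\<lambda>y. f y *\<^sub>R E y + g y *\<^sub>R D y)"
  unfolding C1_deriv_def
proof (intro conjI ballI)
  show "continuous_on U (\<lambda>y. f y *\<^sub>R E y + g y *\<^sub>R D y)"
    using assms C1_deriv_imp_continuous_on[OF assms(1)] C1_deriv_imp_continuous_on[OF assms(2)]
    by (intro continuous_intros) (auto simp: C1_deriv_def)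
  fix y assume "y \<in> U"
  have "((\<lambda>y. f y * g y) has_derivative
      (\<lambda>v. f y * blinfun_apply (E y) v + blinfun_apply (D y) v * g y)) (at y)"
    using assms \<open>y \<in> U\<close> by (intro has_derivative_mult) (auto simp: C1_deriv_def)
  then show "((\<lambda>y. f y * g y) has_derivative blinfun_apply (f y *\<^sub>R E y + g y *\<^sub>R D y)) (at y)"
    by (rule has_derivative_eq_rhs) (auto simp: blinfun.add_left blinfun.scaleR_left)
qed

lemma C1_deriv_const: "C1_deriv U (\<lambda>_. c) (\<lambda>_. 0)"
  by (auto simp: C1_deriv_def zero_blinfun.rep_eq)

lemma C1_deriv_scale:
  assumes "C1_deriv U f D"
  shows "C1_deriv U (\<lambda>y. c * f y) (\<lambda>y. c *\<^sub>R D y)"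
  using C1_deriv_mult[OF C1_deriv_const[of U c] assms] by simp

lemma C1_deriv_compose_real:
  assumes f: "C1_deriv U f D"
    and h: "\<And>s. (h has_real_derivative h' s) (at s)" and h': "continuous_on UNIV h'"
  shows "C1_deriv U (\<lambda>y. h (f y)) (\<lambda>y. h' (f y) *\<^sub>R D y)"
  unfolding C1_deriv_def
proof (intro conjI ballI)
  have "continuous_on U (\<lambda>y. h' (f y))"
    using continuous_on_compose2[OF h' C1_deriv_imp_continuous_on[OF f]] by simp
  then show "continuous_on U (\<lambda>y. h' (f y) *\<^sub>R D y)"
    using f by (intro continuous_intros) (auto simp: C1_deriv_def)
  fix y assume "y \<in> U"
  then have "(f has_derivative blinfun_apply (D y)) (at y)"
    using f by (simp add: C1_deriv_def)
  from has_derivative_compose[OF this h[THEN has_field_derivative_imp_has_derivative]]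
  show "((\<lambda>y. h (f y)) has_derivative blinfun_apply (h' (f y) *\<^sub>R D y)) (at y)"
    by (rule has_derivative_eq_rhs) (auto simp: blinfun.scaleR_left)
qed

lemma C1_deriv_norm_shift:
  assumes "C1_deriv (- {0}) norm n" "x \<notin> U"
  shows "C1_deriv U (\<lambda>y. norm (y - x)) (\<lambda>y. n (y - x))"
  unfolding C1_deriv_def
proof (intro conjI ballI)
  show "continuous_on U (\<lambda>y. n (y - x))"
  proof (rule continuous_on_compose2[of "- {0}" n])
    show "continuous_on (- {0}) n" using assms by (simp add: C1_deriv_def)
    show "continuous_on U (\<lambda>y. y - x)" by (intro continuous_intros)
    show "(\<lambda>y. y - x) ` U \<subseteq> - {0}" using assms by auto
  qed
  fix y assume "y \<in> U"
  then have "(norm has_derivative blinfun_apply (n (y - x))) (at (y - x))"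
    using assms by (auto simp: C1_deriv_def)
  moreover have "((\<lambda>y. y - x) has_derivative (\<lambda>v. v)) (at y)"
    by (auto intro!: derivative_eq_intros)
  ultimately show "((\<lambda>y. norm (y - x)) has_derivative blinfun_apply (n (y - x))) (at y)"
    by (rule has_derivative_compose[rotated])
qed

text \<open>The norm is nonexpansive, hence so are its difference quotients and their limits.\<close>

lemma norm_derivative_of_norm_le_1:
  assumes "(norm has_derivative blinfun_apply L) (at (y::'a::real_normed_vector))"
  shows "norm L \<le> 1"
proof (rule norm_blinfun_bound)
  fix v :: 'a
  have "((\<lambda>t::real. norm (y + t *\<^sub>R v)) has_derivative (\<lambda>t. blinfun_apply L (t *\<^sub>R v))) (at 0)"
  proof (rule has_derivative_compose[where g = norm])
    show "((\<lambda>t::real. y + t *\<^sub>R v) has_derivative (\<lambda>t. t *\<^sub>R v)) (at 0)"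
      by (auto intro!: derivative_eq_intros)
    show "(norm has_derivative blinfun_apply L) (at (y + 0 *\<^sub>R v))" using assms by simp
  qed
  then have "((\<lambda>t. norm (y + t *\<^sub>R v)) has_real_derivative L v) (at 0)"
    by (simp add: has_field_derivative_def blinfun.scaleR_right mult_commute_abs)
  then have "((\<lambda>t. (norm (y + t *\<^sub>R v) - norm y) / t) \<longlongrightarrow> L v) (at 0)"
    by (simp add: has_field_derivative_iff)
  then have "((\<lambda>t. norm ((norm (y + t *\<^sub>R v) - norm y) / t)) \<longlongrightarrow> norm (L v)) (at 0)"
    by (rule tendsto_norm)
  moreover have "\<forall>\<^sub>F t in at 0. norm ((norm (y + t *\<^sub>R v) - norm y) / t) \<le> norm v"
  proof (rule eventually_at_filter[THEN iffD2], rule always_eventually, intro allI impI)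
    fix t :: real assume "t \<noteq> 0"
    have "\<bar>norm (y + t *\<^sub>R v) - norm y\<bar> \<le> norm (t *\<^sub>R v)"
      by (metis add_diff_cancel_left' norm_triangle_ineq3)
    then show "norm ((norm (y + t *\<^sub>R v) - norm y) / t) \<le> norm v"
      using \<open>t \<noteq> 0\<close> by (simp add: field_simps)
  qed
  ultimately show "norm (L v) \<le> 1 * norm v"
    using tendsto_upperbound[OF _ _ trivial_limit_at] by fastforce
qed simp

text \<open>Near each point only the indices of one finite set \<open>T\<close> contribute, so there the sum is the
  finite sum over \<open>T \<inter> I\<close>.\<close>

lemma C1_deriv_locally_finite_sum:
  assumes U: "open U"
    and C1: "\<And>i. i \<in> I \<Longrightarrow> C1_deriv U (w i) (D i)"
    and act: "\<And>y. y \<in> U \<Longrightarrow> act y \<subseteq> I"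
    and zero: "\<And>y i. y \<in> U \<Longrightarrow> i \<in> I - act y \<Longrightarrow> w i y = 0 \<and> D i y = 0"
    and fin: "\<And>y. y \<in> U \<Longrightarrow> \<exists>e>0. \<exists>T. finite T \<and> (\<forall>z\<in>ball y e \<inter> U. act z \<subseteq> T)"
  shows "C1_deriv U (\<lambda>y. \<Sum>i\<in>act y. w i y) (\<lambda>y. \<Sum>i\<in>act y. D i y)"
proof -
  have "isCont (\<lambda>y. \<Sum>i\<in>act y. D i y) y \<and>
        ((\<lambda>y. \<Sum>i\<in>act y. w i y) has_derivative blinfun_apply (\<Sum>i\<in>act y. D i y)) (at y)"
    if y: "y \<in> U" for y
  proof -
    from fin[OF y] obtain e T where e: "e > 0" "finite T" "\<And>z. z \<in> ball y e \<inter> U \<Longrightarrow> act z \<subseteq> T"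
      by blast
    define V where "V = ball y e \<inter> U"
    have V: "open V" "y \<in> V" using U e y by (auto simp: V_def)
    have w_eq: "(\<Sum>i\<in>act z. w i z) = (\<Sum>i\<in>T \<inter> I. w i z)"
      and D_eq: "(\<Sum>i\<in>act z. D i z) = (\<Sum>i\<in>T \<inter> I. D i z)" if "z \<in> V" for z
    proof -
      have "act z \<subseteq> T \<inter> I" "z \<in> U" using e act that by (auto simp: V_def)
      then show "(\<Sum>i\<in>act z. w i z) = (\<Sum>i\<in>T \<inter> I. w i z)"
        "(\<Sum>i\<in>act z. D i z) = (\<Sum>i\<in>T \<inter> I. D i z)"
        using zero e(2) by (auto intro!: sum.mono_neutral_left)
    qed
    have *: "C1_deriv U (\<lambda>y. \<Sum>i\<in>T \<inter> I. w i y) (\<lambda>y. \<Sum>i\<in>T \<inter> I. D i y)"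
      using C1 by (intro C1_deriv_sum) auto
    have der: "((\<lambda>y. \<Sum>i\<in>act y. w i y) has_derivative blinfun_apply (\<Sum>i\<in>T \<inter> I. D i y)) (at y)"
      by (rule has_derivative_transform_within_open[OF _ V])
        (use * y in \<open>simp_all add: C1_deriv_def w_eq\<close>)
    have "isCont (\<lambda>y. \<Sum>i\<in>T \<inter> I. D i y) y"
      using * y U by (auto simp: C1_deriv_def continuous_on_eq_continuous_at)
    moreover have "\<forall>\<^sub>F z in nhds y. (\<Sum>i\<in>act z. D i z) = (\<Sum>i\<in>T \<inter> I. D i z)"
      using V D_eq by (auto simp: eventually_nhds)
    ultimately have "isCont (\<lambda>y. \<Sum>i\<in>act y. D i y) y"
      by (rule isCont_cong[THEN iffD2, rotated])
    with der show ?thesis by (simp only: D_eq[OF V(2)] simp_thms)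
  qed
  then show ?thesis
    using U by (auto simp: C1_deriv_def continuous_on_eq_continuous_at)
qed

section \<open>Finitely supported scalar and vector measures\<close>

text \<open>The points carrying the mass are indexed, possibly with repetitions, because the same point of
  \<open>X\<close> may serve at several scales.\<close>

definition discrete_measure :: "'a::topological_space set \<Rightarrow> 'i set \<Rightarrow> ('i \<Rightarrow> real) \<Rightarrow> ('i \<Rightarrow> 'a) \<Rightarrow> 'a measure" where
  "discrete_measure X J c p = distr (point_measure J c) (borel_on X) p"

definition discrete_vmeasure :: "'i set \<Rightarrow> ('i \<Rightarrow> 'b) \<Rightarrow> ('i \<Rightarrow> 'a) \<Rightarrow> 'a set \<Rightarrow> 'b::real_normed_vector" where
  "discrete_vmeasure J v p A = (\<Sum>i\<in>{i \<in> J. p i \<in> A}. v i)"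

lemma finite_subset_sets_borel_on:
  fixes X :: "'a::t1_space set"
  shows "T \<subseteq> X \<Longrightarrow> finite T \<Longrightarrow> T \<in> sets (borel_on X)"
  by (auto simp: sets_restrict_space intro!: image_eqI[of _ _ T] borel_closed finite_imp_closed)

context
  fixes X :: "'a::t1_space set" and J :: "'i set" and p :: "'i \<Rightarrow> 'a"
  assumes J: "finite J" and p: "\<And>i. i \<in> J \<Longrightarrow> p i \<in> X"
begin

lemma measurable_points: "p \<in> measurable (point_measure J c) (borel_on X)"
  using p by (auto simp: measurable_def space_point_measure sets_point_measure space_restrict_space)

lemma discrete_measure_prob:
  assumes "\<And>i. i \<in> J \<Longrightarrow> c i \<ge> 0" "(\<Sum>i\<in>J. c i) = 1"
  shows "discrete_measure X J c p \<in> borel_prob_measures X"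
proof -
  interpret prob_space "point_measure J c"
    using J assms by (intro prob_space_point_measure) auto
  show ?thesis
    unfolding borel_prob_measures_def discrete_measure_def
    using prob_space_distr[OF measurable_points] by simp
qed

lemma integral_discrete_measure:
  fixes f :: "'a \<Rightarrow> real"
  assumes "\<And>i. i \<in> J \<Longrightarrow> c i \<ge> 0" and f: "f \<in> borel_measurable (borel_on X)"
  shows "integrable (discrete_measure X J c p) f"
    and "(\<integral>x. f x \<partial>discrete_measure X J c p) = (\<Sum>i\<in>J. c i * f (p i))"
proof -
  show "integrable (discrete_measure X J c p) f"
    unfolding discrete_measure_def
    using J assms by (subst integrable_distr_eq[OF measurable_points f]) (auto intro: integrable_point_measure_finite)
  show "(\<integral>x. f x \<partial>discrete_measure X J c p) = (\<Sum>i\<in>J. c i * f (p i))"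
    unfolding discrete_measure_def
    using J assms by (subst integral_distr[OF measurable_points f]) (simp add: lebesgue_integral_point_measure_finite)
qed

lemma AE_discrete_measure_closed:
  assumes "closed K" "\<And>i. i \<in> J \<Longrightarrow> p i \<in> K"
  shows "AE x in discrete_measure X J c p. x \<in> K"
  unfolding discrete_measure_def
proof (subst AE_distr_iff[OF measurable_points])
  have "{x \<in> space (borel_on X). x \<in> K} = X \<inter> K" by (auto simp: space_restrict_space)
  then show "{x \<in> space (borel_on X). x \<in> K} \<in> sets (borel_on X)"
    using assms by (auto simp: sets_restrict_space borel_closed)
  show "AE x in point_measure J c. p x \<in> K"
    using assms by (auto simp: AE_point_measure)
qed

text \<open>Each index lies in at most one member of a partition.\<close>

lemma variation_discrete_vmeasure_le:
  "vmeasure_variation X (discrete_vmeasure J v p) A \<le> ennreal (\<Sum>i\<in>{i \<in> J. p i \<in> A}. norm (v i))"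
  unfolding vmeasure_variation_def
proof (rule SUP_least, clarify)
  fix P :: "'a set set" assume P: "finite P" "disjoint P" "A = \<Union>P"
  have "(\<Sum>E\<in>P. ennreal (norm (discrete_vmeasure J v p E)))
      = ennreal (\<Sum>E\<in>P. norm (discrete_vmeasure J v p E))"
    by (rule sum_ennreal) simp
  also have "\<dots> \<le> ennreal (\<Sum>E\<in>P. \<Sum>i\<in>{i \<in> J. p i \<in> E}. norm (v i))"
    unfolding discrete_vmeasure_def by (intro ennreal_leI sum_mono norm_sum)
  also have "(\<Sum>E\<in>P. \<Sum>i\<in>{i \<in> J. p i \<in> E}. norm (v i)) = (\<Sum>i\<in>(\<Union>E\<in>P. {i \<in> J. p i \<in> E}). norm (v i))"
    using P J by (intro sum.UNION_disjoint[symmetric]) (auto simp: disjoint_def)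
  also have "(\<Union>E\<in>P. {i \<in> J. p i \<in> E}) = {i \<in> J. p i \<in> \<Union>P}" by auto
  finally show "(\<Sum>E\<in>P. ennreal (norm (discrete_vmeasure J v p E)))
      \<le> ennreal (\<Sum>i\<in>{i \<in> J. p i \<in> \<Union>P}. norm (v i))" .
qed

lemma TV_discrete_vmeasure_le: "TV_norm X (discrete_vmeasure J v p) \<le> ennreal (\<Sum>i\<in>J. norm (v i))"
proof -
  have "{i \<in> J. p i \<in> X} = J" using p by auto
  then show ?thesis using variation_discrete_vmeasure_le[of v X] by simp
qed

lemma discrete_vmeasure_finite: "discrete_vmeasure J v p \<in> finite_vmeasures X"
  unfolding finite_vmeasures_def
proof (intro CollectI conjI allI impI)
  show "TV_norm X (discrete_vmeasure J v p) < \<infinity>"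
    using TV_discrete_vmeasure_le[of v] by (simp add: le_less_trans)
  fix A :: "nat \<Rightarrow> 'a set" assume A: "disjoint_family A"
  have *: "discrete_vmeasure J v p B = (\<Sum>i\<in>J. if p i \<in> B then v i else 0)" for B
    unfolding discrete_vmeasure_def using J by (simp add: sum.inter_filter)
  have "(\<lambda>n. if p i \<in> A n then v i else 0) sums (if p i \<in> (\<Union>n. A n) then v i else 0)" for i
  proof (cases "p i \<in> (\<Union>n. A n)")
    case True
    then obtain n where n: "p i \<in> A n" by blast
    then have "(\<lambda>m. if p i \<in> A m then v i else 0) = (\<lambda>m. if m = n then v i else 0)"
      using A by (intro ext) (auto simp: disjoint_family_on_def)
    then show ?thesis using True sums_single[of n "\<lambda>_. v i"] by simp
  qed auto
  then show "(\<lambda>n. discrete_vmeasure J v p (A n)) sums discrete_vmeasure J v p (\<Union>n. A n)"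
    unfolding * by (rule sums_sum)
qed

text \<open>A function agrees outside a null set with the simple function that cuts it off to the finite
  support, so the constant sequence of this simple function already converges to it.\<close>

lemma has_integral_discrete_vmeasure:
  assumes "continuous_on X f"
  shows "has_vmeasure_integral X (discrete_vmeasure J v p) f (\<Sum>i\<in>J. f (p i) *\<^sub>R v i)"
proof -
  define s where "s x = (if x \<in> p ` J then f x else 0)" for x
  define \<nu> where "\<nu> = discrete_vmeasure J v p"
  have s_f: "s (p i) = f (p i)" if "i \<in> J" for i
    using that by (simp add: s_def)
  have f: "f \<in> borel_measurable (borel_on X)"
    using assms by (rule borel_measurable_continuous_on_restrict)
  have pJ: "p ` J \<in> sets (borel_on X)"
    using J p by (intro finite_subset_sets_borel_on) auto
  have s_range: "finite (s ` B)" for B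
  proof (rule finite_subset)
    show "s ` B \<subseteq> insert 0 (f ` p ` J)" by (auto simp: s_def)
  qed (use J in auto)
  have s_meas: "s \<in> borel_measurable (borel_on X)"
    unfolding s_def using f pJ p
    by (intro measurable_If_set) (auto simp: space_restrict_space Int_absorb2 image_subset_iff)
  have s: "simple_function (borel_on X) s"
    by (rule simple_function_borel_measurable[OF s_meas s_range])
  have null: "emeasure (variation_measure X \<nu>) (X - p ` J) = 0"
  proof -
    have "{i \<in> J. p i \<in> X - p ` J} = {}" by auto
    then have "vmeasure_variation X \<nu> (X - p ` J) \<le> ennreal 0"
      unfolding \<nu>_def using variation_discrete_vmeasure_le[of v "X - p ` J"] by (metis sum.empty)
    then have "vmeasure_variation X \<nu> (X - p ` J) = 0" by simp
    \<comment> \<open>\<open>measure_of\<close> takes the value of the variation or, by default, \<open>0\<close>; both are \<open>0\<close> here.\<close>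
    then show ?thesis
      unfolding variation_measure_def by (simp add: emeasure_measure_of_conv)
  qed
  have sub: "sets (borel_on X) \<subseteq> Pow X"
    using sets.space_closed[of "borel_on X"] by (simp add: space_restrict_space)
  have sets_v: "sets (variation_measure X \<nu>) = sets (borel_on X)"
    unfolding variation_measure_def using sub sets.sigma_sets_eq[of "borel_on X"]
    by (simp add: space_restrict_space)
  have space_v: "space (variation_measure X \<nu>) = X"
    unfolding variation_measure_def using sub by simp
  have "AE x in variation_measure X \<nu>. x \<in> p ` J"
  proof (rule AE_I[OF _ null])
    show "X - p ` J \<in> sets (variation_measure X \<nu>)"
      using sets_v pJ sets.compl_sets[OF pJ] by (simp add: space_restrict_space)
  qed (auto simp: space_v)
  then have "(\<integral>\<^sup>+x. ennreal \<bar>f x - s x\<bar> \<partial>variation_measure X \<nu>) = (\<integral>\<^sup>+x. 0 \<partial>variation_measure X \<nu>)"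
    by (intro nn_integral_cong_AE) (auto simp: s_def)
  moreover have "(\<Sum>c\<in>s ` X. c *\<^sub>R \<nu> (s -` {c} \<inter> X)) = (\<Sum>i\<in>J. f (p i) *\<^sub>R v i)"
  proof -
    have "(\<Sum>c\<in>s ` X. c *\<^sub>R \<nu> (s -` {c} \<inter> X))
        = (\<Sum>c\<in>s ` X. \<Sum>i\<in>{i \<in> J. s (p i) = c}. f (p i) *\<^sub>R v i)"
    proof (rule sum.cong[OF refl])
      fix c
      have "{i \<in> J. p i \<in> s -` {c} \<inter> X} = {i \<in> J. s (p i) = c}" using p by auto
      then show "c *\<^sub>R \<nu> (s -` {c} \<inter> X) = (\<Sum>i\<in>{i \<in> J. s (p i) = c}. f (p i) *\<^sub>R v i)"
        unfolding \<nu>_def discrete_vmeasure_def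
        using s_f by (auto simp: scaleR_sum_right intro!: sum.cong)
    qed
    also have "\<dots> = (\<Sum>i\<in>J. f (p i) *\<^sub>R v i)"
      using J p s_range by (intro sum.group) auto
    finally show ?thesis .
  qed
  ultimately show ?thesis
    unfolding has_vmeasure_integral_def \<nu>_def[symmetric]
    using f s by (auto intro!: exI[of _ "\<lambda>_. s"])
qed

end

section \<open>Random projections from partitions of unity\<close>

text \<open>A \<open>C\<^sup>1\<close> partition of unity \<open>w\<close> on the complement of \<open>X\<close> whose members are attached to points
  \<open>p i\<close> of \<open>X\<close> at distance comparable to \<open>infdist y X\<close> gives the random projection
  \<open>\<mu> y = (\<Sum>i. w i y \<delta>\<^bsub>p i\<^esub>)\<close>. Differentiating under the finite sum shows that its associated family
  is \<open>\<nu> y = (\<Sum>i. dw i y \<delta>\<^bsub>p i\<^esub>)\<close>. On \<open>X\<close> the only possible choice is the Dirac measure, and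
  continuity there holds because the mass is carried by points that tend to the base point.\<close>

locale projection_partition =
  fixes X :: "'a::real_normed_vector set" and I :: "'i set"
    and w :: "'i \<Rightarrow> 'a \<Rightarrow> real" and D :: "'i \<Rightarrow> 'a \<Rightarrow> 'a \<Rightarrow>\<^sub>L real"
    and p :: "'i \<Rightarrow> 'a" and act :: "'a \<Rightarrow> 'i set" and \<eta> :: real
  assumes X: "closed X"
    and \<eta>: "\<eta> > 0"
    and C1: "\<And>i. i \<in> I \<Longrightarrow> C1_deriv (- X) (w i) (D i)"
    and act_sub: "\<And>y. y \<in> - X \<Longrightarrow> act y \<subseteq> I"
    and act_zero: "\<And>y i. y \<in> - X \<Longrightarrow> i \<in> I - act y \<Longrightarrow> w i y = 0 \<and> D i y = 0"
    and act_finite: "\<And>y. y \<in> - X \<Longrightarrow> \<exists>e>0. \<exists>T. finite T \<and> (\<forall>z\<in>ball y e \<inter> - X. act z \<subseteq> T)"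
    and points: "\<And>y i. y \<in> - X \<Longrightarrow> i \<in> act y \<Longrightarrow> p i \<in> X \<and> dist y (p i) \<le> \<eta> * infdist y X"
    and nonneg: "\<And>y i. y \<in> - X \<Longrightarrow> i \<in> act y \<Longrightarrow> 0 \<le> w i y"
    and total: "\<And>y. y \<in> - X \<Longrightarrow> (\<Sum>i\<in>act y. w i y) = 1"
begin

definition proj :: "'a \<Rightarrow> 'a measure" where
  "proj y = (if y \<in> X then discrete_measure X {y} (\<lambda>_. 1) id
             else discrete_measure X (act y) (\<lambda>i. w i y) p)"

definition assoc :: "'a \<Rightarrow> 'a set \<Rightarrow> ('a \<Rightarrow>\<^sub>L real)" where
  "assoc y = discrete_vmeasure (act y) (\<lambda>i. D i y) p"

lemma proj_on: "y \<in> X \<Longrightarrow> proj y = discrete_measure X {y} (\<lambda>_. 1) id"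
  and proj_off: "y \<in> - X \<Longrightarrow> proj y = discrete_measure X (act y) (\<lambda>i. w i y) p"
  by (simp_all add: proj_def)

lemma finite_act: "y \<in> - X \<Longrightarrow> finite (act y)"
  using act_finite by (metis IntI centre_in_ball rev_finite_subset)

lemma proj_prob: "proj y \<in> borel_prob_measures X"
proof (cases "y \<in> X")
  case True
  then show ?thesis unfolding proj_on[OF True] by (intro discrete_measure_prob) auto
next
  case False
  then have y: "y \<in> - X" by simp
  show ?thesis
    unfolding proj_off[OF y] using y finite_act points nonneg total
    by (intro discrete_measure_prob) auto
qed

lemma proj_concentrated: "AE x in proj y. x \<in> cball y (\<eta> * infdist y X)"
proof (cases "y \<in> X")
  case True
  then show ?thesis unfolding proj_on[OF True] by (intro AE_discrete_measure_closed) auto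
next
  case False
  then have y: "y \<in> - X" by simp
  show ?thesis
    unfolding proj_off[OF y] using y finite_act points
    by (intro AE_discrete_measure_closed) auto
qed

context
  fixes f :: "'a \<Rightarrow> real"
  assumes f: "continuous_on X f"
begin

lemma f_measurable: "f \<in> borel_measurable (borel_on X)"
  using f by (rule borel_measurable_continuous_on_restrict)

lemma proj_integrable: "integrable (proj y) f"
proof (cases "y \<in> X")
  case True
  then show ?thesis
    unfolding proj_on[OF True] using f_measurable by (intro integral_discrete_measure) auto
next
  case False
  then have y: "y \<in> - X" by simp
  show ?thesis
    unfolding proj_off[OF y] using f_measurable y finite_act points nonneg
    by (intro integral_discrete_measure) auto
qed

lemma integral_proj_on:
  assumes "y \<in> X"
  shows "(\<integral>x. f x \<partial>proj y) = f y"
proof -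
  have "(\<integral>x. f x \<partial>proj y) = (\<Sum>z\<in>{y}. 1 * f (id z))"
    unfolding proj_on[OF assms] using assms f_measurable
    by (intro integral_discrete_measure) auto
  then show ?thesis by simp
qed

lemma integral_proj_off:
  assumes "y \<in> - X"
  shows "(\<integral>x. f x \<partial>proj y) = (\<Sum>i\<in>act y. f (p i) * w i y)"
proof -
  have "(\<integral>x. f x \<partial>proj y) = (\<Sum>i\<in>act y. w i y * f (p i))"
    unfolding proj_off[OF assms] using assms f_measurable finite_act points nonneg
    by (intro integral_discrete_measure) auto
  then show ?thesis by (simp add: mult.commute)
qed

lemma integral_proj_C1:
  "C1_deriv (- X) (\<lambda>y. \<integral>x. f x \<partial>proj y) (\<lambda>y. \<Sum>i\<in>act y. f (p i) *\<^sub>R D i y)"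
proof -
  have *: "C1_deriv (- X) (\<lambda>y. \<Sum>i\<in>act y. f (p i) * w i y) (\<lambda>y. \<Sum>i\<in>act y. f (p i) *\<^sub>R D i y)"
  proof (rule C1_deriv_locally_finite_sum)
    show "open (- X)" using X by auto
    show "C1_deriv (- X) (\<lambda>y. f (p i) * w i y) (\<lambda>y. f (p i) *\<^sub>R D i y)" if "i \<in> I" for i
      using C1[OF that] by (rule C1_deriv_scale)
  qed (use act_sub act_zero act_finite in auto)
  then show ?thesis
    unfolding C1_deriv_def
  proof (elim conjE, intro conjI ballI)
    fix y assume "y \<in> - X"
      and "\<forall>y\<in>- X. ((\<lambda>y. \<Sum>i\<in>act y. f (p i) * w i y) has_derivative
                    blinfun_apply (\<Sum>i\<in>act y. f (p i) *\<^sub>R D i y)) (at y)"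
    then have "((\<lambda>y. \<Sum>i\<in>act y. f (p i) * w i y) has_derivative
                    blinfun_apply (\<Sum>i\<in>act y. f (p i) *\<^sub>R D i y)) (at y)"
      by blast
    then show "((\<lambda>y. \<integral>x. f x \<partial>proj y) has_derivative
                    blinfun_apply (\<Sum>i\<in>act y. f (p i) *\<^sub>R D i y)) (at y)"
      by (rule has_derivative_transform_within_open[of _ _ _ _ "- X"])
        (use X \<open>y \<in> - X\<close> integral_proj_off in \<open>auto simp: open_Compl\<close>)
  qed
qed

lemma integral_proj_continuous: "continuous_on UNIV (\<lambda>y. \<integral>x. f x \<partial>proj y)"
proof (rule continuous_at_imp_continuous_on, rule ballI)
  fix y
  show "isCont (\<lambda>y. \<integral>x. f x \<partial>proj y) y"
  proof (cases "y \<in> X")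
    case False
    then show ?thesis
      using C1_deriv_imp_continuous_on[OF integral_proj_C1] X
      by (simp add: continuous_on_eq_continuous_at open_Compl)
  next
    case True
    show ?thesis
      unfolding continuous_at_eps_delta
    proof (intro allI impI)
      fix e :: real assume e: "e > 0"
      obtain d where d: "d > 0" "\<And>x. x \<in> X \<Longrightarrow> dist x y < d \<Longrightarrow> dist (f x) (f y) < e / 2"
        using f True e unfolding continuous_on_iff by (metis half_gt_zero)
      \<comment> \<open>The mass of \<open>proj z\<close> lies within \<open>\<eta> * dist z y\<close> of \<open>z\<close>, hence within
        \<open>(\<eta> + 1) * dist z y\<close> of \<open>y\<close>.\<close>
      define \<delta> where "\<delta> = d / (\<eta> + 1)"
      have \<delta>: "0 < \<delta>" "\<delta> \<le> d" using d \<eta> by (auto simp: \<delta>_def field_simps)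
      have "dist (\<integral>x. f x \<partial>proj z) (\<integral>x. f x \<partial>proj y) < e" if z: "dist z y < \<delta>" for z
      proof (cases "z \<in> X")
        case zX: True
        then have "dist (f z) (f y) < e / 2" using d z \<delta> by auto
        then show ?thesis using e by (simp add: integral_proj_on True zX)
      next
        case zX: False
        have close: "\<bar>f (p i) - f y\<bar> \<le> e / 2" if i: "i \<in> act z" for i
        proof -
          have "dist z (p i) \<le> \<eta> * infdist z X" "p i \<in> X" using points[of z i] zX i by auto
          moreover have "\<eta> * infdist z X \<le> \<eta> * dist z y"
            using infdist_le[OF True] \<eta> by (intro mult_left_mono) auto
          moreover have "dist (p i) y \<le> dist z (p i) + dist z y" by (metis dist_commute dist_triangle)
          ultimately have "dist (p i) y \<le> (\<eta> + 1) * dist z y" by (simp add: algebra_simps)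
          also have "\<dots> < (\<eta> + 1) * \<delta>" using z \<eta> by (intro mult_strict_left_mono) auto
          also have "\<dots> = d" using \<eta> by (simp add: \<delta>_def)
          finally show ?thesis using d(2)[OF \<open>p i \<in> X\<close>] by (simp add: dist_real_def)
        qed
        have "(\<integral>x. f x \<partial>proj z) - f y = (\<Sum>i\<in>act z. f (p i) * w i z) - (\<Sum>i\<in>act z. w i z) * f y"
          using zX total[of z] by (simp add: integral_proj_off)
        also have "\<dots> = (\<Sum>i\<in>act z. (f (p i) - f y) * w i z)"
          by (simp add: left_diff_distrib right_diff_distrib sum_subtractf sum_distrib_left mult.commute)
        finally have eq: "(\<integral>x. f x \<partial>proj z) - f y = (\<Sum>i\<in>act z. (f (p i) - f y) * w i z)" .
        have "\<bar>(\<integral>x. f x \<partial>proj z) - f y\<bar> \<le> (\<Sum>i\<in>act z. \<bar>(f (p i) - f y) * w i z\<bar>)"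
          unfolding eq by (rule sum_abs)
        also have "\<dots> \<le> (\<Sum>i\<in>act z. e / 2 * w i z)"
        proof (rule sum_mono)
          fix i assume i: "i \<in> act z"
          then have "0 \<le> w i z" using nonneg[of z i] zX by simp
          then show "\<bar>(f (p i) - f y) * w i z\<bar> \<le> e / 2 * w i z"
            using close[OF i] by (simp only: abs_mult abs_of_nonneg mult_right_mono)
        qed
        also have "\<dots> = e / 2" using total[of z] zX sum_distrib_left[of "e / 2" "\<lambda>i. w i z" "act z"] by simp
        finally show ?thesis using e by (simp add: integral_proj_on[OF True] dist_real_def)
      qed
      then show "\<exists>d>0. \<forall>z. dist z y < d \<longrightarrow>
          dist (\<integral>x. f x \<partial>proj z) (\<integral>x. f x \<partial>proj y) < e"
        using \<delta> by blast
    qed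
  qed
qed

end

lemma TV_assoc_le: "y \<in> - X \<Longrightarrow> TV_norm X (assoc y) \<le> ennreal (\<Sum>i\<in>act y. norm (D i y))"
  unfolding assoc_def using finite_act points by (intro TV_discrete_vmeasure_le) auto

lemma proj_regular:
  assumes B: "\<And>y. y \<in> - X \<Longrightarrow> (\<Sum>i\<in>act y. norm (D i y)) \<le> B / infdist y X"
  shows "regular_random_projection_with X proj assoc"
  unfolding regular_random_projection_with_def
proof (intro conjI)
  show "\<forall>y. proj y \<in> borel_prob_measures X" using proj_prob by blast
  show "\<forall>y\<in>- X. assoc y \<in> finite_vmeasures X"
    unfolding assoc_def using finite_act points by (intro ballI discrete_vmeasure_finite) auto
  have "has_vmeasure_integral X (assoc y) f (\<Sum>i\<in>act y. f (p i) *\<^sub>R D i y)"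
    if "continuous_on X f" "y \<in> - X" for f y
    unfolding assoc_def using that finite_act points by (intro has_integral_discrete_vmeasure) auto
  then have diff: "\<exists>L. ((\<lambda>z. \<integral>x. f x \<partial>proj z) has_derivative blinfun_apply L) (at y) \<and>
      has_vmeasure_integral X (assoc y) f L" if "continuous_on X f" "y \<in> - X" for f y
    using that integral_proj_C1[OF that(1)] unfolding C1_deriv_def by blast
  have conc: "vmeasure_variation X (assoc y) (X - cball y (\<eta> * infdist y X)) = 0" if y: "y \<in> - X" for y
  proof -
    have none: "{i \<in> act y. p i \<in> X - cball y (\<eta> * infdist y X)} = {}"
      using points[OF y] by auto
    have "vmeasure_variation X (assoc y) (X - cball y (\<eta> * infdist y X))
        \<le> ennreal (\<Sum>i\<in>{i \<in> act y. p i \<in> X - cball y (\<eta> * infdist y X)}. norm (D i y))"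
      unfolding assoc_def using finite_act[OF y] points[OF y]
      by (intro variation_discrete_vmeasure_le) auto
    then show ?thesis unfolding none by simp
  qed
  have "TV_norm X (assoc y) \<le> ennreal (B / infdist y X)" if "y \<in> - X" for y
    using TV_assoc_le[OF that] ennreal_leI[OF B[OF that]] by (rule order_trans)
  then have TV: "\<exists>C. \<forall>y\<in>- X. TV_norm X (assoc y) \<le> ennreal (C / infdist y X)" by blast
  show "\<exists>\<eta>>0.
      (\<forall>y. AE x in proj y. x \<in> cball y (\<eta> * infdist y X)) \<and>
      (\<forall>f. continuous_on X f \<longrightarrow>
         (\<forall>y. integrable (proj y) f) \<and>
         continuous_on UNIV (\<lambda>y. \<integral>x. f x \<partial>proj y) \<and>
         C1_on (\<lambda>y. \<integral>x. f x \<partial>proj y) (- X) \<and>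
         (\<forall>y\<in>- X. \<exists>L. ((\<lambda>z. \<integral>x. f x \<partial>proj z) has_derivative blinfun_apply L) (at y) \<and>
            has_vmeasure_integral X (assoc y) f L)) \<and>
      (\<forall>y\<in>- X. vmeasure_variation X (assoc y) (X - cball y (\<eta> * infdist y X)) = 0) \<and>
      (\<exists>C. \<forall>y\<in>- X. TV_norm X (assoc y) \<le> ennreal (C / infdist y X))"
  proof (rule exI[of _ \<eta>], intro conjI allI impI)
    fix f :: "'a \<Rightarrow> real" assume f: "continuous_on X f"
    show "integrable (proj y) f" for y using f by (rule proj_integrable)
    show "continuous_on UNIV (\<lambda>y. \<integral>x. f x \<partial>proj y)" using f by (rule integral_proj_continuous)
    show "C1_on (\<lambda>y. \<integral>x. f x \<partial>proj y) (- X)"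
      using integral_proj_C1[OF f] by (rule C1_deriv_imp_C1_on)
    show "\<forall>y\<in>- X. \<exists>L. ((\<lambda>z. \<integral>x. f x \<partial>proj z) has_derivative blinfun_apply L) (at y) \<and>
        has_vmeasure_integral X (assoc y) f L"
      using diff[OF f] by blast
  qed (use \<eta> conc proj_concentrated TV in blast)+
qed

end

section \<open>Separated sets and nets in doubling spaces\<close>

lemma doubling_cover:
  assumes X: "doubling_with X l" and x: "x \<in> X" and r: "r > 0"
  shows "\<exists>S. S \<subseteq> X \<and> finite S \<and> card S \<le> l ^ n \<and> ball x (2 ^ n * r) \<inter> X \<subseteq> (\<Union>s\<in>S. ball s r)"
  using r
proof (induction n arbitrary: r)
  case 0
  show ?case using x by (intro exI[of _ "{x}"]) auto
next
  case (Suc n)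
  from Suc.IH[of "2 * r"] Suc.prems obtain S where S: "S \<subseteq> X" "finite S" "card S \<le> l ^ n"
      "ball x (2 ^ n * (2 * r)) \<inter> X \<subseteq> (\<Union>s\<in>S. ball s (2 * r))"
    by auto
  have "\<forall>s\<in>S. \<exists>T. T \<subseteq> X \<and> finite T \<and> card T \<le> l \<and> ball s (2 * r) \<inter> X \<subseteq> (\<Union>t\<in>T. ball t r)"
    using X S(1) Suc.prems unfolding doubling_with_def by blast
  then obtain T where T: "\<And>s. s \<in> S \<Longrightarrow> T s \<subseteq> X \<and> finite (T s) \<and> card (T s) \<le> l \<and>
      ball s (2 * r) \<inter> X \<subseteq> (\<Union>t\<in>T s. ball t r)"
    by metis
  have "card (\<Union>s\<in>S. T s) \<le> (\<Sum>s\<in>S. card (T s))" by (rule card_UN_le[OF S(2)])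
  also have "\<dots> \<le> (\<Sum>s\<in>S. l)" using T by (intro sum_mono) auto
  also have "\<dots> \<le> l ^ Suc n" using S(3) by simp
  finally have "card (\<Union>s\<in>S. T s) \<le> l ^ Suc n" .
  moreover have "ball x (2 ^ Suc n * r) \<inter> X \<subseteq> (\<Union>t\<in>(\<Union>s\<in>S. T s). ball t r)"
  proof
    fix z assume z: "z \<in> ball x (2 ^ Suc n * r) \<inter> X"
    then have "z \<in> ball x (2 ^ n * (2 * r)) \<inter> X" by (simp add: ac_simps)
    with S(4) obtain s where "s \<in> S" "z \<in> ball s (2 * r) \<inter> X" using z by blast
    then show "z \<in> (\<Union>t\<in>(\<Union>s\<in>S. T s). ball t r)" using T[of s] by blast
  qed
  ultimately show ?case
    using S T by (intro exI[of _ "\<Union>s\<in>S. T s"]) blast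
qed

text \<open>A ball of radius \<open>r / 2\<close> contains at most one point of an \<open>r\<close>-separated set.\<close>

lemma separated_card_le:
  assumes X: "doubling_with X l" and x: "x \<in> X" and r: "r > 0"
    and E: "E \<subseteq> X" "E \<subseteq> ball x (2 ^ n * (r / 2))"
    and sep: "\<And>a b. a \<in> E \<Longrightarrow> b \<in> E \<Longrightarrow> a \<noteq> b \<Longrightarrow> r \<le> dist a b"
  shows "finite E" "card E \<le> l ^ n"
proof -
  from doubling_cover[OF X x, of "r / 2" n] r obtain S where
    S: "finite S" "card S \<le> l ^ n" "ball x (2 ^ n * (r / 2)) \<inter> X \<subseteq> (\<Union>s\<in>S. ball s (r / 2))"
    by auto
  have "\<forall>a\<in>E. \<exists>s. s \<in> S \<and> dist s a < r / 2" using S(3) E by fastforce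
  then obtain c where c: "\<And>a. a \<in> E \<Longrightarrow> c a \<in> S \<and> dist (c a) a < r / 2" by metis
  have inj: "inj_on c E"
  proof (rule inj_onI, rule ccontr)
    fix a b assume *: "a \<in> E" "b \<in> E" "c a = c b" "a \<noteq> b"
    then have "dist a b < r"
      using c[of a] c[of b] dist_triangle_half_l[of a "c a" r b] by (simp add: dist_commute)
    then show False using sep[of a b] * by simp
  qed
  have sub: "c ` E \<subseteq> S" using c by auto
  show "finite E" using inj sub S(1) by (rule inj_on_finite)
  show "card E \<le> l ^ n" using card_inj_on_le[OF inj sub S(1)] S(2) by simp
qed

lemma separated_bounded_finite:
  fixes y :: "'a::metric_space"
  assumes X: "doubling_with X l" and r: "r > 0" and E: "E \<subseteq> X"
    and sep: "\<And>a b. a \<in> E \<Longrightarrow> b \<in> E \<Longrightarrow> a \<noteq> b \<Longrightarrow> r \<le> dist a b"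
  shows "finite {x \<in> E. dist y x < R}"
proof (cases "\<exists>a\<in>E. dist y a < R")
  case True
  then obtain a where a: "a \<in> E" "dist y a < R" by blast
  obtain n where n: "2 * R / (r / 2) < 2 ^ n" using real_arch_pow[of 2] by auto
  have "x \<in> ball a (2 ^ n * (r / 2))" if "dist y x < R" for x
  proof -
    have "dist a x < 2 * R" using that a dist_triangle3[of a x y] by simp
    then show ?thesis using n r by (simp add: field_simps)
  qed
  then show ?thesis
    using a E r sep by (intro separated_card_le(1)[OF X, of a r _ n]) auto
next
  case False
  then have "{x \<in> E. dist y x < R} = {}" by blast
  then show ?thesis by (simp only: finite.emptyI)
qed

text \<open>The two points \<open>a \<noteq> b\<close> would be a \<open>dist a b\<close>-separated set, and a ball that contains them has room
  for only \<open>1 ^ 2\<close> points of such a set.\<close>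

lemma doubling_with_1_imp_singleton:
  assumes "doubling_with X 1" "a \<in> X" "b \<in> X"
  shows "a = b"
proof (rule ccontr)
  assume "a \<noteq> b"
  then have "card {a, b} \<le> 1 ^ 2"
    using assms by (intro separated_card_le(2)[of X 1 a "dist a b"]) (auto simp: dist_commute)
  then show False using \<open>a \<noteq> b\<close> by simp
qed

text \<open>A maximal \<open>r\<close>-separated set is \<open>r\<close>-dense.\<close>

lemma separated_net_exists:
  fixes X :: "'a::metric_space set"
  assumes "r > 0"
  shows "\<exists>N. N \<subseteq> X \<and> (\<forall>a\<in>N. \<forall>b\<in>N. a \<noteq> b \<longrightarrow> r \<le> dist a b) \<and> (\<forall>x\<in>X. \<exists>a\<in>N. dist x a < r)"
proof -
  define \<N> where "\<N> = {N. N \<subseteq> X \<and> (\<forall>a\<in>N. \<forall>b\<in>N. a \<noteq> b \<longrightarrow> r \<le> dist a b)}"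
  have "\<Union>\<C> \<in> \<N>" if C: "subset.chain \<N> \<C>" for \<C>
    unfolding \<N>_def
  proof (intro CollectI conjI ballI impI)
    show "\<Union>\<C> \<subseteq> X" using C by (auto simp: subset_chain_def \<N>_def)
    fix a b assume ab: "a \<in> \<Union>\<C>" "b \<in> \<Union>\<C>" "a \<noteq> b"
    then obtain A B where "A \<in> \<C>" "B \<in> \<C>" "a \<in> A" "b \<in> B" by blast
    moreover from this have "A \<subseteq> B \<or> B \<subseteq> A" "A \<in> \<N>" "B \<in> \<N>"
      using C by (auto simp: subset_chain_def)
    ultimately show "r \<le> dist a b" using ab(3) unfolding \<N>_def by blast
  qed
  then obtain N where N: "N \<in> \<N>" "\<And>M. M \<in> \<N> \<Longrightarrow> N \<subseteq> M \<Longrightarrow> M = N"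
    using subset_Zorn'[of \<N>] by blast
  have "\<exists>a\<in>N. dist x a < r" if x: "x \<in> X" for x
  proof (rule ccontr)
    assume "\<not> (\<exists>a\<in>N. dist x a < r)"
    then have far: "r \<le> dist x a" if "a \<in> N" for a using that by force
    then have "insert x N \<in> \<N>" using N(1) x by (auto simp: \<N>_def dist_commute)
    then have "x \<in> N" using N(2)[of "insert x N"] by blast
    then show False using far[of x] assms by simp
  qed
  moreover have "N \<subseteq> X \<and> (\<forall>a\<in>N. \<forall>b\<in>N. a \<noteq> b \<longrightarrow> r \<le> dist a b)"
    using N(1) by (simp add: \<N>_def)
  ultimately show ?thesis by (intro exI[of _ N] conjI ballI) auto
qed

lemma dyadic_scale_exists:
  assumes "(d::real) > 0"
  shows "\<exists>k::int. 2 * 2 powi k \<le> d \<and> d < 4 * 2 powi k"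
proof
  define k where "k = \<lfloor>log 2 d\<rfloor> - 1"
  have "2 powr real_of_int (k + 1) \<le> 2 powr log 2 d"
    by (intro powr_mono) (auto simp: k_def)
  moreover have "2 powr log 2 d < 2 powr real_of_int (k + 2)"
    unfolding k_def by (intro powr_less_mono) linarith+
  moreover have "2 powr log 2 d = d" using assms by simp
  moreover have "2 powr real_of_int (k + 1) = 2 powi (k + 1)" "2 powr real_of_int (k + 2) = 2 powi (k + 2)"
    by (rule powr_real_of_int'; simp)+
  moreover have "(2::real) powi (k + 1) = 2 * 2 powi k" "(2::real) powi (k + 2) = 4 * 2 powi k"
    by (simp_all add: power_int_add)
  ultimately show "2 * 2 powi k \<le> d \<and> d < 4 * 2 powi k" by simp
qed

section \<open>Scalar profiles\<close>

text \<open>The square makes the positive part continuously differentiable.\<close>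

definition ramp :: "real \<Rightarrow> real" where "ramp t = (max 0 t)\<^sup>2"

lemma ramp_deriv: "(ramp has_real_derivative 2 * max 0 t) (at t)"
proof -
  consider "t > 0" | "t < 0" | "t = 0" by linarith
  then show ?thesis
  proof cases
    case 1
    have "((\<lambda>t. t\<^sup>2) has_real_derivative 2 * max 0 t) (at t)"
      using 1 by (auto intro!: derivative_eq_intros)
    then show ?thesis
      by (rule has_field_derivative_transform_within_open[where S = "{0<..}"])
        (use 1 in \<open>auto simp: ramp_def\<close>)
  next
    case 2
    have "((\<lambda>t. 0) has_real_derivative 2 * max 0 t) (at t)"
      using 2 by (auto intro!: derivative_eq_intros)
    then show ?thesis
      by (rule has_field_derivative_transform_within_open[where S = "{..<0}"])
        (use 2 in \<open>auto simp: ramp_def\<close>)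
  next
    case 3
    have le: "norm ((ramp s - ramp 0) / (s - 0)) \<le> norm s" for s
    proof (cases "s > 0")
      case True
      then show ?thesis by (simp add: ramp_def power2_eq_square)
    qed (simp add: ramp_def)
    have "((\<lambda>s. (ramp s - ramp 0) / (s - 0)) \<longlongrightarrow> 0) (at 0)"
      by (rule Lim_null_comparison[OF always_eventually tendsto_norm_zero[OF tendsto_ident_at]])
        (use le in blast)
    then show ?thesis by (simp add: 3 has_field_derivative_iff)
  qed
qed

lemma ramp_nonneg: "0 \<le> ramp t"
  and ramp_eq_0: "t \<le> 0 \<Longrightarrow> ramp t = 0"
  by (simp_all add: ramp_def)

lemma ramp_ge_1: "1 \<le> t \<Longrightarrow> 1 \<le> ramp t"
  by (simp add: ramp_def)

text \<open>If the bumps of a net add up to \<open>s\<close>, each of them is multiplied by \<open>rescale s\<close>. The total mass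
  becomes \<open>s * rescale s\<close>, which is at most \<open>1\<close>, with equality once \<open>s \<ge> 1\<close>; the mass \<open>gap s\<close> that
  is left over goes to the next coarser net. Dividing by \<open>s\<close> alone would make the derivatives blow up
  where \<open>s\<close> is small; the additional term \<open>ramp (1 - s)\<close> keeps the denominator above \<open>1 / 2\<close>.
  The primed functions are the derivatives.\<close>

definition damped :: "real \<Rightarrow> real" where "damped s = s + ramp (1 - s)"
definition rescale :: "real \<Rightarrow> real" where "rescale s = 1 / damped s"
definition rescale' :: "real \<Rightarrow> real" where "rescale' s = - (1 - 2 * max 0 (1 - s)) / (damped s)\<^sup>2"
definition gap :: "real \<Rightarrow> real" where "gap s = 1 - s * rescale s"
definition gap' :: "real \<Rightarrow> real" where "gap' s = - (rescale s + s * rescale' s)"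

lemma damped_ge: "1 / 2 \<le> damped s"
proof (cases "s \<le> 1")
  case True
  have "damped s = (s - 1 / 2)\<^sup>2 + 3 / 4"
    using True by (simp add: damped_def ramp_def power2_eq_square algebra_simps)
  then show ?thesis using zero_le_power2[of "s - 1 / 2"] by linarith
qed (simp add: damped_def ramp_def)

lemma damped_pos: "0 < damped s"
  using damped_ge[of s] by simp

lemma damped_eq: "1 \<le> s \<Longrightarrow> damped s = s"
  by (simp add: damped_def ramp_eq_0)

lemma damped_deriv: "(damped has_real_derivative 1 - 2 * max 0 (1 - s)) (at s)"
proof -
  have "((\<lambda>s. ramp (1 - s)) has_real_derivative 2 * max 0 (1 - s) * (- 1)) (at s)"
    by (rule DERIV_chain2[OF ramp_deriv]) (auto intro!: derivative_eq_intros)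
  then have "((\<lambda>s. s + ramp (1 - s)) has_real_derivative 1 + 2 * max 0 (1 - s) * (- 1)) (at s)"
    by (intro DERIV_add DERIV_ident)
  then show ?thesis by (simp add: damped_def[abs_def])
qed

lemma rescale_deriv: "(rescale has_real_derivative rescale' s) (at s)"
  unfolding rescale_def[abs_def] rescale'_def
  using damped_pos[of s]
  by (auto intro!: derivative_eq_intros damped_deriv simp: power2_eq_square)

lemma gap_deriv: "(gap has_real_derivative gap' s) (at s)"
  unfolding gap_def[abs_def] gap'_def
  by (auto intro!: derivative_eq_intros rescale_deriv)

lemma continuous_on_rescale: "continuous_on UNIV rescale"
  using rescale_deriv by (auto intro!: continuous_at_imp_continuous_on DERIV_isCont)

lemma continuous_on_rescale': "continuous_on UNIV rescale'"
proof -
  have "continuous_on UNIV damped"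
    using damped_deriv by (auto intro!: continuous_at_imp_continuous_on DERIV_isCont)
  then show ?thesis
    unfolding rescale'_def using damped_pos by (intro continuous_intros) (auto simp: less_le)
qed

lemma continuous_on_gap': "continuous_on UNIV gap'"
  unfolding gap'_def by (intro continuous_intros continuous_on_rescale continuous_on_rescale')

lemma rescale_bounds: "0 \<le> rescale s" "rescale s \<le> 2"
  using damped_ge[of s] by (simp_all add: rescale_def field_simps)

lemma
  assumes "0 \<le> s"
  shows mass_nonneg: "0 \<le> s * rescale s" and mass_le_1: "s * rescale s \<le> 1"
    and mass_rescale'_le: "s * \<bar>rescale' s\<bar> \<le> 2"
proof -
  show "0 \<le> s * rescale s" using assms rescale_bounds by simp
  show 1: "s * rescale s \<le> 1"
    using damped_pos[of s] ramp_nonneg[of "1 - s"] by (simp add: rescale_def field_simps damped_def)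
  have "\<bar>1 - 2 * max 0 (1 - s)\<bar> \<le> 1" using assms by (simp add: abs_le_iff max_def)
  then have "\<bar>rescale' s\<bar> \<le> 1 / (damped s)\<^sup>2"
    unfolding rescale'_def by (simp add: abs_divide divide_right_mono)
  then have "s * \<bar>rescale' s\<bar> \<le> s * (1 / (damped s)\<^sup>2)" using assms by (rule mult_left_mono)
  also have "\<dots> = (s * rescale s) * rescale s" by (simp add: rescale_def power2_eq_square)
  also have "\<dots> \<le> 1 * 2" using 1 rescale_bounds by (intro mult_mono) auto
  finally show "s * \<bar>rescale' s\<bar> \<le> 2" by simp
qed

lemma gap_bounds: "0 \<le> s \<Longrightarrow> 0 \<le> gap s" "0 \<le> s \<Longrightarrow> gap s \<le> 1"
  using mass_nonneg mass_le_1 by (simp_all add: gap_def)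

lemma gap_0: "gap 0 = 1"
  by (simp add: gap_def)

lemma gap_ge_1: "1 \<le> s \<Longrightarrow> gap s = 0"
  and gap'_ge_1: "1 \<le> s \<Longrightarrow> gap' s = 0"
  by (auto simp: gap_def gap'_def rescale_def rescale'_def damped_eq power2_eq_square)

lemma abs_gap'_le:
  assumes "0 \<le> s"
  shows "\<bar>gap' s\<bar> \<le> 4"
proof -
  have "\<bar>s * rescale' s\<bar> \<le> 2" using mass_rescale'_le[OF assms] assms by (simp add: abs_mult)
  then show ?thesis unfolding gap'_def using rescale_bounds[of s] by linarith
qed

section \<open>The partition of unity of a sequence of dyadic nets\<close>

locale dyadic_nets =
  fixes X :: "'a::real_normed_vector set" and N :: "int \<Rightarrow> 'a set"
    and n :: "'a \<Rightarrow> 'a \<Rightarrow>\<^sub>L real" and l :: nat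
  assumes X: "closed X" "X \<noteq> {}" "doubling_with X l"
    and norm_C1: "C1_deriv (- {0}) norm n"
    and N_sub: "N k \<subseteq> X"
    and N_sep: "a \<in> N k \<Longrightarrow> b \<in> N k \<Longrightarrow> a \<noteq> b \<Longrightarrow> 2 powi k \<le> dist a b"
    and N_dense: "x \<in> X \<Longrightarrow> \<exists>a\<in>N k. dist x a < 2 powi k"
begin

text \<open>The names with a prime are the derivatives in \<open>y\<close>. The radii in \<open>near\<close> and \<open>bump\<close> agree, so that
  exactly the points of \<open>near k y\<close> have a positive bump at \<open>y\<close>.\<close>

definition near :: "int \<Rightarrow> 'a \<Rightarrow> 'a set" where
  "near k y = {x \<in> N k. dist y x < 4 * 2 powi k}"

definition bump :: "int \<Rightarrow> 'a \<Rightarrow> 'a \<Rightarrow> real" where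
  "bump k x y = ramp (4 - norm (y - x) / 2 powi k)"

definition bump' :: "int \<Rightarrow> 'a \<Rightarrow> 'a \<Rightarrow> 'a \<Rightarrow>\<^sub>L real" where
  "bump' k x y = (- (2 * max 0 (4 - norm (y - x) / 2 powi k)) / 2 powi k) *\<^sub>R n (y - x)"

definition cov :: "int \<Rightarrow> 'a \<Rightarrow> real" where
  "cov k y = (\<Sum>x\<in>near k y. bump k x y)"

definition cov' :: "int \<Rightarrow> 'a \<Rightarrow> 'a \<Rightarrow>\<^sub>L real" where
  "cov' k y = (\<Sum>x\<in>near k y. bump' k x y)"

text \<open>What the net of scale \<open>k\<close> would give to \<open>x\<close> if it were not preceded by finer nets.\<close>

definition share :: "int \<Rightarrow> 'a \<Rightarrow> 'a \<Rightarrow> real" where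
  "share k x y = bump k x y * rescale (cov k y)"

definition share' :: "int \<Rightarrow> 'a \<Rightarrow> 'a \<Rightarrow> 'a \<Rightarrow>\<^sub>L real" where
  "share' k x y = bump k x y *\<^sub>R (rescale' (cov k y) *\<^sub>R cov' k y) + rescale (cov k y) *\<^sub>R bump' k x y"

text \<open>Scale \<open>k\<close> only receives what the next finer scale leaves over. Where the weight is not \<open>0\<close>, the gaps
  at all scales finer than \<open>k - 1\<close> are \<open>1\<close>, so one factor stands for the product over all finer scales.\<close>

definition weight :: "int \<times> 'a \<Rightarrow> 'a \<Rightarrow> real" where
  "weight = (\<lambda>(k, x) y. gap (cov (k - 1) y) * share k x y)"

definition weight' :: "int \<times> 'a \<Rightarrow> 'a \<Rightarrow> 'a \<Rightarrow>\<^sub>L real" where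
  "weight' = (\<lambda>(k, x) y. gap (cov (k - 1) y) *\<^sub>R share' k x y
      + share k x y *\<^sub>R (gap' (cov (k - 1) y) *\<^sub>R cov' (k - 1) y))"

definition act :: "'a \<Rightarrow> (int \<times> 'a) set" where
  "act y = (SIGMA k:{k. 2 powi k \<le> infdist y X}. near k y)"

lemma two_powi_pos: "(0::real) < 2 powi k"
  by simp

lemma two_powi_pred: "(2::real) powi k = 2 * 2 powi (k - 1)"
  by (simp add: power_int_diff)

lemma two_powi_less: "(2::real) powi j < 2 powi k \<Longrightarrow> j < k"
  by (metis linorder_not_less one_le_numeral power_int_increasing)

lemma infdist_pos: "y \<in> - X \<Longrightarrow> 0 < infdist y X"
  using X infdist_pos_not_in_closed by blast

lemma finite_net_ball: "finite {x \<in> N k. dist y x < R}"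
  using X(3) two_powi_pos N_sub N_sep by (rule separated_bounded_finite)

lemma finite_near: "finite (near k y)"
  unfolding near_def by (rule finite_net_ball)

text \<open>Four halvings lead from the radius \<open>8 * 2 powi k\<close>, a bound for the diameter of \<open>near k y\<close>, to
  half of the separation of the net.\<close>

lemma card_near_le: "card (near k y) \<le> l ^ 4"
proof (cases "near k y = {}")
  case False
  then obtain a where a: "a \<in> near k y" by blast
  have "dist a x < 2 ^ 4 * (2 powi k / 2)" if "x \<in> near k y" for x
    using that a dist_triangle3[of a x y] by (simp add: near_def)
  then show ?thesis
    using a N_sub[of k] N_sep
    by (intro separated_card_le(2)[OF X(3), of a "2 powi k"]) (auto simp: near_def)
qed simp

lemma bump_nonneg: "0 \<le> bump k x y"
  by (simp add: bump_def ramp_nonneg)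

lemma bump_far:
  assumes "x \<in> N k - near k y"
  shows "bump k x y = 0 \<and> bump' k x y = 0"
proof -
  have "4 * 2 powi k \<le> norm (y - x)" using assms by (auto simp: near_def dist_norm)
  then have "4 \<le> norm (y - x) / 2 powi k" by (simp add: field_simps)
  then show ?thesis by (simp add: bump_def bump'_def ramp_eq_0)
qed

lemma cov_nonneg: "0 \<le> cov k y"
  unfolding cov_def by (intro sum_nonneg bump_nonneg)

lemma cov_eq_0:
  assumes "4 * 2 powi k \<le> infdist y X"
  shows "cov k y = 0"
proof -
  have "4 * 2 powi k \<le> dist y x" if "x \<in> N k" for x
    using assms infdist_le[of x X y] N_sub that by fastforce
  then have "near k y = {}" by (force simp: near_def)
  then show ?thesis by (simp add: cov_def)
qed

text \<open>A point of \<open>X\<close> within \<open>2 * 2 powi k\<close> of \<open>y\<close> has a net point within \<open>2 powi k\<close>, hence within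
  \<open>3 * 2 powi k\<close> of \<open>y\<close>, where the bump is at least \<open>ramp 1\<close>. Together with \<open>cov_eq_0\<close> this makes the
  differentiable function \<open>cov k\<close> a substitute for comparing \<open>infdist y X\<close> with \<open>2 powi k\<close>.\<close>

lemma cov_ge_1:
  assumes "infdist y X < 2 * 2 powi k"
  shows "1 \<le> cov k y"
proof -
  obtain z where z: "z \<in> X" "dist y z < 2 * 2 powi k"
    using assms X(2) by (auto simp: infdist_notempty cINF_less_iff)
  obtain x where x: "x \<in> N k" "dist z x < 2 powi k" using N_dense[OF z(1)] by blast
  have d: "dist y x < 3 * 2 powi k" using z x dist_triangle[of y x z] by simp
  then have "1 \<le> bump k x y"
    unfolding bump_def by (intro ramp_ge_1) (simp add: dist_norm field_simps)
  also have "dist y x < 4 * 2 powi k" using d two_powi_pos[of k] by linarith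
  then have "x \<in> near k y" using x by (simp add: near_def)
  then have "bump k x y \<le> cov k y"
    unfolding cov_def using finite_near bump_nonneg by (intro member_le_sum) auto
  finally show ?thesis .
qed

lemma bump_C1:
  assumes "x \<in> X"
  shows "C1_deriv (- X) (bump k x) (bump' k x)"
proof -
  have x: "x \<notin> - X" using assms by simp
  have "C1_deriv (- X) (\<lambda>y. ramp (4 - norm (y - x) / 2 powi k))
      (\<lambda>y. (- (2 * max 0 (4 - norm (y - x) / 2 powi k)) / 2 powi k) *\<^sub>R n (y - x))"
  proof (rule C1_deriv_compose_real[OF C1_deriv_norm_shift[OF norm_C1 x],
        where h = "\<lambda>s. ramp (4 - s / 2 powi k)"])
    fix s :: real
    have "((\<lambda>s. 4 - s / 2 powi k) has_real_derivative - (1 / 2 powi k)) (at s)"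
      by (auto intro!: derivative_eq_intros)
    from DERIV_chain2[OF ramp_deriv this]
    show "((\<lambda>s. ramp (4 - s / 2 powi k)) has_real_derivative
        - (2 * max 0 (4 - s / 2 powi k)) / 2 powi k) (at s)"
      by simp
  qed (intro continuous_intros, simp_all)
  then show ?thesis by (simp add: bump_def[abs_def] bump'_def[abs_def])
qed

lemma cov_C1: "C1_deriv (- X) (cov k) (cov' k)"
proof -
  have "C1_deriv (- X) (\<lambda>y. \<Sum>x\<in>near k y. bump k x y) (\<lambda>y. \<Sum>x\<in>near k y. bump' k x y)"
  proof (rule C1_deriv_locally_finite_sum[where I = "N k"])
    show "open (- X)" using X by auto
    show "C1_deriv (- X) (bump k x) (bump' k x)" if "x \<in> N k" for x
      using bump_C1 N_sub that by blast
    show "near k y \<subseteq> N k" for y by (auto simp: near_def)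
    show "bump k x y = 0 \<and> bump' k x y = 0" if "x \<in> N k - near k y" for x y
      using that by (rule bump_far)
    fix y
    have "near k z \<subseteq> {x \<in> N k. dist y x < 5 * 2 powi k}" if "z \<in> ball y (2 powi k)" for z
    proof
      fix x assume "x \<in> near k z"
      then show "x \<in> {x \<in> N k. dist y x < 5 * 2 powi k}"
        using that dist_triangle[of y x z] by (simp add: near_def)
    qed
    then show "\<exists>e>0. \<exists>T. finite T \<and> (\<forall>z\<in>ball y e \<inter> - X. near k z \<subseteq> T)"
      using finite_net_ball[of k y "5 * 2 powi k"] two_powi_pos[of k] by blast
  qed
  then show ?thesis by (simp add: cov_def[abs_def] cov'_def[abs_def])
qed

lemma weight_C1:
  assumes "x \<in> X"
  shows "C1_deriv (- X) (weight (k, x)) (weight' (k, x))"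
proof -
  have "C1_deriv (- X) (\<lambda>y. bump k x y * rescale (cov k y))
     (\<lambda>y. bump k x y *\<^sub>R (rescale' (cov k y) *\<^sub>R cov' k y) + rescale (cov k y) *\<^sub>R bump' k x y)"
    by (rule C1_deriv_mult[OF bump_C1[OF assms]
          C1_deriv_compose_real[OF cov_C1 rescale_deriv continuous_on_rescale']])
  then have "C1_deriv (- X) (share k x) (share' k x)"
    by (simp add: share_def[abs_def] share'_def[abs_def])
  from C1_deriv_mult[OF C1_deriv_compose_real[OF cov_C1 gap_deriv continuous_on_gap'] this, of "k - 1"]
  show ?thesis by (simp add: weight_def weight'_def)
qed

lemma weight_nonneg: "0 \<le> weight i y"
  using gap_bounds cov_nonneg bump_nonneg rescale_bounds
  by (auto simp: weight_def share_def split: prod.split)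

text \<open>A net point that is too far has a vanishing bump. At a scale that is too coarse, the next finer
  net already receives the full mass and leaves a gap of zero.\<close>

lemma weight_inactive:
  assumes "i \<in> Sigma UNIV N - act y"
  shows "weight i y = 0 \<and> weight' i y = 0"
proof -
  obtain k x where i: "i = (k, x)" "x \<in> N k" using assms by auto
  show ?thesis
  proof (cases "2 powi k \<le> infdist y X")
    case True
    then have "x \<in> N k - near k y" using assms i by (auto simp: act_def)
    then have "bump k x y = 0" "bump' k x y = 0" using bump_far by blast+
    then show ?thesis by (simp add: i weight_def weight'_def share_def share'_def)
  next
    case False
    then have "1 \<le> cov (k - 1) y" using two_powi_pred[of k] by (intro cov_ge_1) simp
    then show ?thesis by (simp add: i weight_def weight'_def gap_ge_1 gap'_ge_1)
  qed
qed

lemma near_nonempty_scale: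
  assumes "x \<in> near k y"
  shows "infdist y X < 4 * 2 powi k"
proof -
  have "x \<in> X" "dist y x < 4 * 2 powi k" using assms N_sub[of k] by (auto simp: near_def)
  then show ?thesis using infdist_le[of x X y] by linarith
qed

text \<open>Only two scales are active at a given point.\<close>

lemma act_two_scales:
  assumes k: "2 * 2 powi k \<le> infdist y X" "infdist y X < 4 * 2 powi k"
  shows "act y = (SIGMA j:{k, k + 1}. near j y)"
proof -
  have "j = k \<or> j = k + 1" if j: "2 powi j \<le> infdist y X" "infdist y X < 4 * 2 powi j" for j
  proof -
    have "(2::real) powi (k - 1) < 2 powi j" "(2::real) powi j < 2 powi (k + 2)"
      using j k two_powi_pred[of k] by (simp_all add: power_int_add)
    then have "k - 1 < j" "j < k + 2" by (blast dest: two_powi_less)+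
    then show ?thesis by linarith
  qed
  moreover have "2 powi k \<le> infdist y X" "2 powi (k + 1) \<le> infdist y X"
    using k two_powi_pos[of k] two_powi_pred[of "k + 1"] by simp_all
  ultimately have "2 powi j \<le> infdist y X \<longleftrightarrow> j = k \<or> j = k + 1" if "x \<in> near j y" for j x
    using near_nonempty_scale[OF that] by metis
  then show ?thesis
    unfolding act_def
    by (intro set_eqI) (auto simp only: mem_Sigma_iff mem_Collect_eq insert_iff empty_iff)
qed

lemma sum_act:
  assumes "2 * 2 powi k \<le> infdist y X" "infdist y X < 4 * 2 powi k"
  shows "(\<Sum>i\<in>act y. g i) = (\<Sum>x\<in>near k y. g (k, x)) + (\<Sum>x\<in>near (k + 1) y. g (k + 1, x))"
proof -
  have "(\<Sum>i\<in>act y. g i) = (\<Sum>j\<in>{k, k + 1}. \<Sum>x\<in>near j y. g (j, x))"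
    unfolding act_two_scales[OF assms] using finite_near by (simp add: sum.Sigma)
  then show ?thesis by simp
qed

lemma sum_share: "(\<Sum>x\<in>near k y. share k x y) = 1 - gap (cov k y)"
  unfolding share_def gap_def sum_distrib_right[symmetric] cov_def[symmetric] by simp

text \<open>If \<open>g\<close> is the gap at the finer of the two active scales, then the gap before it is \<open>1\<close> and the gap
  after it is \<open>0\<close>, so the two scales receive the masses \<open>1 - g\<close> and \<open>g\<close>.\<close>

lemma weight_total:
  assumes y: "y \<in> - X"
  shows "(\<Sum>i\<in>act y. weight i y) = 1"
proof -
  obtain k where k: "2 * 2 powi k \<le> infdist y X" "infdist y X < 4 * 2 powi k"
    using dyadic_scale_exists[OF infdist_pos[OF y]] by blast
  have "gap (cov (k - 1) y) = 1"
    using k(1) two_powi_pred[of k] by (subst cov_eq_0) (auto simp: gap_0)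
  moreover have "gap (cov (k + 1) y) = 0"
    using k(2) by (intro gap_ge_1 cov_ge_1) (simp add: power_int_add)
  moreover have "(\<Sum>x\<in>near j y. weight (j, x) y) = gap (cov (j - 1) y) * (1 - gap (cov j y))" for j
    unfolding weight_def prod.case sum_distrib_left[symmetric] sum_share ..
  ultimately show ?thesis by (simp add: sum_act[OF k])
qed

text \<open>Moving \<open>y\<close> by a quarter of its distance from \<open>X\<close> changes the active scales by a bounded number of
  steps, and each net has finitely many points in a bounded region.\<close>

lemma act_locally_finite:
  assumes y: "y \<in> - X"
  shows "\<exists>e>0. \<exists>T. finite T \<and> (\<forall>z\<in>ball y e \<inter> - X. act z \<subseteq> T)"
proof -
  define d where "d = infdist y X"
  have d: "d > 0" unfolding d_def using y by (rule infdist_pos)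
  obtain k where k: "2 * 2 powi k \<le> d" "d < 4 * 2 powi k"
    using dyadic_scale_exists[OF d] by blast
  have "act z \<subseteq> (SIGMA j:{k - 1..k + 2}. {x \<in> N j. dist y x < 4 * 2 powi j + d})"
    if z: "z \<in> ball y (d / 4)" for z
  proof clarify
    fix j x assume "(j, x) \<in> act z"
    then have j: "2 powi j \<le> infdist z X" "x \<in> near j z" by (auto simp: act_def)
    have "\<bar>infdist y X - infdist z X\<bar> \<le> dist y z" by (rule infdist_triangle_abs)
    then have dz: "3 / 4 * d < infdist z X" "infdist z X < 5 / 4 * d"
      using z by (auto simp: d_def)
    have "(2::real) powi (k - 2) < 2 powi j" "(2::real) powi j < 2 powi (k + 3)"
      using j(1) dz k near_nonempty_scale[OF j(2)] by (simp_all add: power_int_add power_int_diff)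
    then have "k - 2 < j" "j < k + 3" by (blast dest: two_powi_less)+
    moreover have "dist y x < 4 * 2 powi j + d"
      using j(2) z d dist_triangle[of y x z] by (simp add: near_def)
    ultimately show "j \<in> {k - 1..k + 2} \<and> x \<in> {x \<in> N j. dist y x < 4 * 2 powi j + d}"
      using j(2) by (auto simp: near_def)
  qed
  moreover have "finite (SIGMA j:{k - 1..k + 2}. {x \<in> N j. dist y x < 4 * 2 powi j + d})"
    using finite_net_ball by blast
  moreover have "0 < d / 4" using d by simp
  ultimately show ?thesis by blast
qed

sublocale projection_partition X "Sigma UNIV N" weight weight' snd act 4
proof unfold_locales
  fix y i assume "i \<in> act y"
  then have "snd i \<in> N (fst i)" "dist y (snd i) < 4 * 2 powi fst i" "2 powi fst i \<le> infdist y X"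
    by (auto simp: act_def near_def)
  moreover from this have "snd i \<in> X" using N_sub by blast
  ultimately show "snd i \<in> X \<and> dist y (snd i) \<le> 4 * infdist y X" by linarith
qed (use X(1) weight_C1 N_sub weight_inactive act_locally_finite weight_nonneg weight_total
     in \<open>auto simp: act_def near_def\<close>)

subsection \<open>The total variation\<close>

lemma norm_bump'_le:
  assumes "x \<in> X" "y \<in> - X"
  shows "norm (bump' k x y) \<le> 8 / 2 powi k"
proof -
  have "norm (n (y - x)) \<le> 1"
    using norm_C1 assms by (intro norm_derivative_of_norm_le_1) (auto simp: C1_deriv_def)
  moreover have "\<bar>2 * max 0 (4 - norm (y - x) / 2 powi k)\<bar> \<le> 8" by auto
  ultimately have "\<bar>2 * max 0 (4 - norm (y - x) / 2 powi k)\<bar> * norm (n (y - x)) \<le> 8 * 1"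
    by (intro mult_mono) auto
  then show ?thesis
    by (simp add: bump'_def abs_mult divide_right_mono)
qed

text \<open>At most \<open>l ^ 4\<close> bumps of slope at most \<open>8 / 2 powi k\<close> contribute at scale \<open>k\<close>.\<close>

definition slope :: "int \<Rightarrow> real" where
  "slope k = real l ^ 4 * (8 / 2 powi k)"

lemma sum_norm_bump'_le:
  assumes "y \<in> - X"
  shows "(\<Sum>x\<in>near k y. norm (bump' k x y)) \<le> slope k"
proof -
  have "(\<Sum>x\<in>near k y. norm (bump' k x y)) \<le> real (card (near k y)) * (8 / 2 powi k)"
    using norm_bump'_le[OF _ assms] N_sub by (intro sum_bounded_above) (auto simp: near_def)
  also have "\<dots> \<le> real l ^ 4 * (8 / 2 powi k)"
    using card_near_le[of k y] by (intro mult_right_mono) (simp_all flip: of_nat_power)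
  finally show ?thesis by (simp add: slope_def)
qed

lemma norm_cov'_le: "y \<in> - X \<Longrightarrow> norm (cov' k y) \<le> slope k"
  unfolding cov'_def by (rule order_trans[OF norm_sum sum_norm_bump'_le])

text \<open>The sum over the net is estimated as a whole: the terms that contain \<open>cov' k y\<close> carry the factors
  \<open>bump k x y\<close>, whose sum \<open>cov k y\<close> may be of the order of \<open>l ^ 4\<close> but is compensated by \<open>rescale'\<close>.
  Estimating the summands one by one would square the factor \<open>l ^ 4\<close>.\<close>

lemma sum_norm_share'_le:
  assumes y: "y \<in> - X"
  shows "(\<Sum>x\<in>near k y. norm (share' k x y)) \<le> 4 * slope k"
proof -
  let ?s = "cov k y"
  have "(\<Sum>x\<in>near k y. norm (share' k x y))
      \<le> (\<Sum>x\<in>near k y. bump k x y * (\<bar>rescale' ?s\<bar> * norm (cov' k y)) + rescale ?s * norm (bump' k x y))"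
  proof (rule sum_mono)
    fix x
    show "norm (share' k x y)
        \<le> bump k x y * (\<bar>rescale' ?s\<bar> * norm (cov' k y)) + rescale ?s * norm (bump' k x y)"
      unfolding share'_def
      by (rule order_trans[OF norm_triangle_ineq])
        (simp add: bump_nonneg rescale_bounds abs_mult)
  qed
  also have "\<dots> = (?s * \<bar>rescale' ?s\<bar>) * norm (cov' k y) + rescale ?s * (\<Sum>x\<in>near k y. norm (bump' k x y))"
    by (simp add: sum.distrib cov_def sum_distrib_left sum_distrib_right ac_simps)
  also have "\<dots> \<le> 2 * slope k + 2 * slope k"
    using mass_rescale'_le[OF cov_nonneg] rescale_bounds norm_cov'_le[OF y] sum_norm_bump'_le[OF y]
    by (intro add_mono mult_mono) (auto intro: sum_nonneg)
  finally show ?thesis by simp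
qed

lemma sum_norm_weight'_le:
  assumes y: "y \<in> - X"
  shows "(\<Sum>x\<in>near k y. norm (weight' (k, x) y)) \<le> 12 * slope k"
proof -
  let ?s = "cov (k - 1) y"
  have share_nonneg: "0 \<le> share k x y" for x
    by (simp add: share_def bump_nonneg rescale_bounds)
  have "(\<Sum>x\<in>near k y. norm (weight' (k, x) y))
      \<le> (\<Sum>x\<in>near k y. gap ?s * norm (share' k x y) + share k x y * (\<bar>gap' ?s\<bar> * norm (cov' (k - 1) y)))"
  proof (rule sum_mono)
    fix x
    show "norm (weight' (k, x) y)
        \<le> gap ?s * norm (share' k x y) + share k x y * (\<bar>gap' ?s\<bar> * norm (cov' (k - 1) y))"
      unfolding weight'_def prod.case
      by (rule order_trans[OF norm_triangle_ineq])
        (simp add: share_nonneg gap_bounds cov_nonneg abs_mult)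
  qed
  also have "\<dots> = gap ?s * (\<Sum>x\<in>near k y. norm (share' k x y))
      + (\<Sum>x\<in>near k y. share k x y) * (\<bar>gap' ?s\<bar> * norm (cov' (k - 1) y))"
    by (simp add: sum.distrib sum_distrib_left sum_distrib_right)
  also have "\<dots> \<le> 1 * (4 * slope k) + 1 * (4 * slope (k - 1))"
    using gap_bounds[OF cov_nonneg] sum_norm_share'_le[OF y] norm_cov'_le[OF y] abs_gap'_le[OF cov_nonneg]
    by (intro add_mono mult_mono) (auto simp: sum_share intro: sum_nonneg)
  also have "slope (k - 1) = 2 * slope k"
    by (simp add: slope_def power_int_diff)
  finally show ?thesis by simp
qed

text \<open>Both active scales satisfy \<open>2 powi j > infdist y X / 4\<close>, which gives \<open>2 * 12 * 32 = 768\<close>.\<close>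

lemma sum_norm_weight'_act_le:
  assumes y: "y \<in> - X"
  shows "(\<Sum>i\<in>act y. norm (weight' i y)) \<le> 768 * real l ^ 4 / infdist y X"
proof -
  obtain k where k: "2 * 2 powi k \<le> infdist y X" "infdist y X < 4 * 2 powi k"
    using dyadic_scale_exists[OF infdist_pos[OF y]] by blast
  have d: "0 < infdist y X" using y by (rule infdist_pos)
  have "slope j \<le> 32 * real l ^ 4 / infdist y X" if "infdist y X < 4 * 2 powi j" for j
  proof -
    have "8 / 2 powi j \<le> 32 / infdist y X" using that d by (simp add: field_simps)
    then have "real l ^ 4 * (8 / 2 powi j) \<le> real l ^ 4 * (32 / infdist y X)"
      by (intro mult_left_mono) auto
    then show ?thesis by (simp add: slope_def ac_simps)
  qed
  from this[of k] this[of "k + 1"] k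
  have "slope k \<le> 32 * real l ^ 4 / infdist y X" "slope (k + 1) \<le> 32 * real l ^ 4 / infdist y X"
    by (simp_all add: power_int_add)
  then show ?thesis
    using sum_norm_weight'_le[OF y, of k] sum_norm_weight'_le[OF y, of "k + 1"]
    by (simp add: sum_act[OF k])
qed

end

lemma doubling_projection:
  fixes X :: "'a::real_normed_vector set"
  assumes norm: "C1_on (norm :: 'a \<Rightarrow> real) (- {0})"
    and X: "closed X" "X \<noteq> {}" "doubling_with X l"
  shows "\<exists>\<mu> \<nu>. regular_random_projection_with X \<mu> \<nu> \<and>
    (\<forall>y\<in>-X. TV_norm X (\<nu> y) \<le> ennreal (768 * real l ^ 4 / infdist y X))"
proof -
  obtain n :: "'a \<Rightarrow> 'a \<Rightarrow>\<^sub>L real" where n: "C1_deriv (- {0}) norm n"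
    using norm unfolding C1_on_def C1_deriv_def by blast
  have "\<exists>N. N \<subseteq> X \<and> (\<forall>a\<in>N. \<forall>b\<in>N. a \<noteq> b \<longrightarrow> 2 powi k \<le> dist a b) \<and> (\<forall>x\<in>X. \<exists>a\<in>N. dist x a < 2 powi k)"
    for k :: int by (rule separated_net_exists) simp
  then obtain N where N: "N k \<subseteq> X" "\<forall>a\<in>N k. \<forall>b\<in>N k. a \<noteq> b \<longrightarrow> 2 powi k \<le> dist a b"
      "\<forall>x\<in>X. \<exists>a\<in>N k. dist x a < 2 powi k" for k
    by metis
  interpret dyadic_nets X N n l
  proof unfold_locales
    show "closed X" "X \<noteq> {}" "doubling_with X l" "C1_deriv (- {0}) norm n" by fact+
    show "N k \<subseteq> X" for k by (rule N(1))
    show "2 powi k \<le> dist a b" if "a \<in> N k" "b \<in> N k" "a \<noteq> b" for a b k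
      using N(2)[of k] that by blast
    show "\<exists>a\<in>N k. dist x a < 2 powi k" if "x \<in> X" for x k
      using N(3)[of k] that by blast
  qed
  have "regular_random_projection_with X proj assoc"
    using sum_norm_weight'_act_le by (rule proj_regular)
  moreover have "TV_norm X (assoc y) \<le> ennreal (768 * real l ^ 4 / infdist y X)" if "y \<in> - X" for y
    using TV_assoc_le[OF that] ennreal_leI[OF sum_norm_weight'_act_le[OF that]] by (rule order_trans)
  ultimately show ?thesis by blast
qed

lemma singleton_projection:
  fixes x :: "'a::real_normed_vector"
  shows "\<exists>\<mu> \<nu>. regular_random_projection_with {x} \<mu> \<nu> \<and> (\<forall>y\<in>-{x}. TV_norm {x} (\<nu> y) \<le> 0)"
proof -
  interpret projection_partition "{x}" "UNIV :: unit set" "\<lambda>_ _. 1" "\<lambda>_ _. 0" "\<lambda>_. x" "\<lambda>_. UNIV" 1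
  proof unfold_locales
    show "\<exists>e>0. \<exists>T :: unit set. finite T \<and> (\<forall>z\<in>ball y e \<inter> - {x}. UNIV \<subseteq> T)" for y
      by (rule exI[of _ 1]) auto
  qed (auto simp: C1_deriv_const)
  have "regular_random_projection_with {x} proj assoc"
    by (rule proj_regular[of 0]) simp
  moreover have "TV_norm {x} (assoc y) \<le> 0" if "y \<in> - {x}" for y
    using TV_assoc_le[OF that] by simp
  ultimately show ?thesis by blast
qed

text \<open>The factor \<open>ln l\<close> vanishes for \<open>l = 1\<close>, which is therefore treated separately: \<open>X\<close> is then a
  single point and the projection is constant.\<close>

theorem theorem3p6:
  fixes X :: "'a::banach set"
  assumes "C1_on (norm :: 'a \<Rightarrow> real) (- {0})"
    and "closed X" and "X \<noteq> {}"
    and "doubling_space X"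
  shows "0 < universal_const \<and>
    (\<exists>\<mu> \<nu>. regular_random_projection X \<mu> \<and> regular_random_projection_with X \<mu> \<nu> \<and>
       (\<forall>y\<in>-X. TV_norm X (\<nu> y) \<le>
          ennreal (universal_const *
            (real (doubling_constant X) ^ 4 * ln (real (doubling_constant X)) / infdist y X))))"
proof -
  define l where "l = doubling_constant X"
  have l: "doubling_with X l"
    using assms(4) unfolding l_def doubling_constant_def doubling_space_def by (rule LeastI_ex)
  have "\<exists>\<mu> \<nu>. regular_random_projection_with X \<mu> \<nu> \<and>
      (\<forall>y\<in>-X. TV_norm X (\<nu> y) \<le> ennreal (universal_const * (real l ^ 4 * ln (real l) / infdist y X)))"
  proof (cases "l \<le> 1")
    case True
    obtain x where x: "x \<in> X" using assms(3) by blast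
    obtain S where "S \<subseteq> X" "finite S" "card S \<le> l" "ball x (2 * 1) \<inter> X \<subseteq> (\<Union>s\<in>S. ball s 1)"
      using l x unfolding doubling_with_def by (meson zero_less_one)
    moreover have "x \<in> ball x (2 * 1) \<inter> X" using x by simp
    ultimately have "S \<noteq> {}" by blast
    then have "l \<noteq> 0" using \<open>finite S\<close> \<open>card S \<le> l\<close> by auto
    with True have l1: "l = 1" by simp
    have "X = {x}" using doubling_with_1_imp_singleton[of X] l x unfolding l1 by blast
    then show ?thesis using singleton_projection[of x] by (simp add: l1)
  next
    case False
    \<comment> \<open>A lower bound for \<open>ln l\<close>: inserting this factor costs only a numerical constant.\<close>
    have "1 / 2 \<le> ln (2::real)" using ln2_ge_two_thirds by simp
    also have "\<dots> \<le> ln (real l)" using False by simp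
    finally have C: "768 \<le> universal_const * ln (real l)"
      unfolding universal_const_def by simp
    have le: "768 * real l ^ 4 / infdist y X \<le> universal_const * (real l ^ 4 * ln (real l) / infdist y X)" for y
    proof -
      have "768 * (real l ^ 4 / infdist y X) \<le> universal_const * ln (real l) * (real l ^ 4 / infdist y X)"
        using C by (rule mult_right_mono) (simp add: infdist_nonneg)
      then show ?thesis by (simp add: mult.commute mult.left_commute)
    qed
    obtain \<mu> \<nu> where "regular_random_projection_with X \<mu> \<nu>"
      and TV: "\<And>y. y \<in> - X \<Longrightarrow> TV_norm X (\<nu> y) \<le> ennreal (768 * real l ^ 4 / infdist y X)"
      using doubling_projection[OF assms(1-3) l] by blast
    then show ?thesis
      using order_trans[OF TV ennreal_leI[OF le]] by blast
  qed
  moreover have "0 < universal_const" by (simp add: universal_const_def)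
  ultimately show ?thesis
    unfolding regular_random_projection_def l_def by blast
qed

end
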